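(* Consider the fully discrete oscillation-eliminating discontinuous Galerkin (OEDG) method with an SSP Runge–Kutta scheme for the two-dimensional five-equation transport model, as defined in the context. It maintains the Abgrall condition around an isolated material interface: for a constant vector $\mathbf u_0$ and a constant $p_0$, if $$\mathbf u_\sigma^n(x,y)\equiv\mathbf u_0,\qquad p_\sigma^n(x,y)\equiv p_0,$$ then $$\mathbf u_\sigma^{n+1}(x,y)\equiv\mathbf u_0,\qquad p_\sigma^{n+1}(x,y)\equiv p_0,$$ where $\mathbf u_\sigma^{n+1}:=\mathbf u(\mathcal F_{\Delta t}\mathbf U_h^{n+1}(x,y))$ and $p_\sigma^{n+1}:=p(\mathcal F_{\Delta t}\mathbf U_h^{n+1}(x,y))$ (and likewise at time level $n$) denote the velocity and pressure of the numerical solution after the oscillation-eliminating procedure.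
   Context: **Model.** The state is $\mathbf U=(\mathbf W,z_1)$ with $\mathbf W=(z_1\rho_1,z_2\rho_2,\rho u,\rho v,E)$, so $\mathbf U$ has 6 components; $z_k$ and $\rho_k$ are the volume fraction and density of phase $k$, $z_2=1-z_1$, $\rho=z_1\rho_1+z_2\rho_2$, $\mathbf u=(u,v)$ is the velocity and $E$ the total energy. The constants $\gamma_k$, $p_{w,k}$ ($k=1,2$) are the specific heat ratio and reference pressure of phase $k$ in the Tammann equation of state. Velocity and pressure are the functions of $\mathbf U$ given by $\mathbf u(\mathbf U)=(\rho\mathbf u)/\rho$ and $p(\mathbf U)=(E-\frac12\rho|\mathbf u|^2)(\gamma-1)-\gamma p_w$, where $\frac1{\gamma-1}=\frac{z_1}{\gamma_1-1}+\frac{z_2}{\gamma_2-1}$ and $\frac{\gamma p_w}{\gamma-1}=\frac{z_1\gamma_1p_{w,1}}{\gamma_1-1}+\frac{z_2\gamma_2p_{w,2}}{\gamma_2-1}$. The sound speed is $\tilde c=\sqrt{\gamma(p+p_w)/\rho}$. The five-equation transport model is $\partial_t\mathbf W+\nabla\cdot\mathbf F(\mathbf W,z_1)=0$, $\partial_tz_1+\mathbf u\cdot\nabla z_1=0$, with $\mathbf F=(\mathbf F^1,\mathbf F^2)=(z_1\rho_1\mathbf u,\ z_2\rho_2\mathbf u,\ \rho\mathbf u\otimes\mathbf u+p\mathbf I,\ \mathbf u(E+p))^{\mathrm T}$. **Mesh and space.** The computational domain $\Omega$ is divided into uniform Cartesian cells $I_{i,j}=[x_{i-1/2},x_{i+1/2}]\times[y_{j-1/2},y_{j+1/2}]$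 of size $\Delta x\times\Delta y$. $\mathbf U_h$ has components in $V_h^K=\{v\in L^2(\Omega):v|_{I_{i,j}}\in P^K(I_{i,j})\ \forall i,j\}$, with $P^K$ the polynomials of degree at most $K$. On $I_{i,j}$ a local orthogonal Legendre basis $\varphi_{i,j}^{(\boldsymbol\alpha)}$, $\boldsymbol\alpha=(\alpha_1,\alpha_2)$, $|\boldsymbol\alpha|=\alpha_1+\alpha_2\le K$, is used, and $\mathbf U_h=\sum_{|\boldsymbol\alpha|\le K}\mathbf U_{i,j}^{(\boldsymbol\alpha)}\varphi^{(\boldsymbol\alpha)}_{i,j}$ on $I_{i,j}$, with $\mathbf U_{i,j}^{(0)}$ the cell average. At a cell edge, superscripts $-$ and $+$ denote traces from the left/lower and right/upper cell respectively. **Semi-discrete quasi-conservative DG operator $\mathcal L_h$.** $\partial_t\mathbf U_h=\mathcal L_h(\mathbf U_h)$ is defined by requiring, for every cell and every basis function $\varphi=\varphi_{i,j}^{(\boldsymbol\alpha)}$, $$\int_{I_{i,j}}\partial_t\mathbf W\,\varphi\,dS=\int_{I_{i,j}}\mathbf F(\mathbf W,z_1)\cdot\nabla\varphi\,dS-\int_{\partial I_{i,j}}\hat{\mathbf F}\cdot\mathbf n\,\varphi\,dl,$$ $$\int_{I_{i,j}}\partial_tz_1\,\varphi\,dS=-\int_{I_{i,j}}\varphi\,\mathbf u\cdot\nabla z_1\,dS-\int_{\partial I_{i,j}}\varphi\,\widehat{(\mathbf u\cdot\mathbf n z_1)}\,dl+\int_{\partial I_{i,j}^{in}}\varphi\,(\mathbf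 u\cdot\mathbf n z_1)\,dl,$$ where $\mathbf n$ is the outward normal, all quantities in the last integral over $\partial I_{i,j}^{in}$ are interior traces from $I_{i,j}$ (as is $\varphi$ in all boundary integrals), and the numerical fluxes are $\hat{\mathbf F}^d=\frac12(\mathbf F^d(\mathbf W^+,z_1^+)+\mathbf F^d(\mathbf W^-,z_1^-))-\frac{S_d}2(\mathbf W^+-\mathbf W^-)$, $d=1,2$, and $\widehat{(\mathbf u\cdot\mathbf nz_1)}=\pm\widehat{uz_1}$ on right/left edges, $\pm\widehat{vz_1}$ on upper/lower edges, with $$\widehat{uz_1}=\tfrac12u^{in}(z_1^-+z_1^+)-\tfrac12S_1(z_1^+-z_1^-),\quad \widehat{vz_1}=\tfrac12v^{in}(z_1^-+z_1^+)-\tfrac12S_2(z_1^+-z_1^-),$$ $u^{in},v^{in}$ being the traces from inside the current cell $I_{i,j}$, and $S_1=\max\{|u^+|+\tilde c^+,|u^-|+\tilde c^-\}$, $S_2=\max\{|v^+|+\tilde c^+,|v^-|+\tilde c^-\}$. **Oscillation-eliminating operator.** On $I_{i,j}$, with $\Delta t$ the time step size, $$\mathcal F_{\Delta t}\mathbf U_h=\mathbf U_{i,j}^{(0)}\varphi_{i,j}^{(0)}+\sum_{k=1}^Ke^{-\Delta t\sum_{m=0}^k\delta_{i,j}^m(\mathbf U_h)}\sum_{|\boldsymbol\alpha|=k}\mathbf U_{i,j}^{(\boldsymbol\alpha)}\varphi_{i,j}^{(\boldsymbol\alpha)},$$ $$\delta_{i,j}^m(\mathbf U_h)=\max_{1\le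 q\le6}\left(\frac{\beta_{i,j}^x(\sigma^m_{i+\frac12,j}(\mathbf U_h^{(q)})+\sigma^m_{i-\frac12,j}(\mathbf U_h^{(q)}))}{\Delta x}+\frac{\beta_{i,j}^y(\sigma^m_{i,j+\frac12}(\mathbf U_h^{(q)})+\sigma^m_{i,j-\frac12}(\mathbf U_h^{(q)}))}{\Delta y}\right),$$ where $\mathbf U_h^{(q)}$ is the $q$-th component, $\beta^x_{i,j},\beta^y_{i,j}$ are estimates of the local maximum wave speeds in the $x$- and $y$-directions, $\overline{\mathbf U}_\Omega^{(q)}=\frac1{|\Omega|}\int_\Omega\mathbf U_h^{(q)}\,dx\,dy$, $\sigma=0$ if $\mathbf U_h^{(q)}\equiv\overline{\mathbf U}_\Omega^{(q)}$, and otherwise $$\sigma^m_{i+\frac12,j}(\mathbf U_h^{(q)})=\frac{(2m+1)\Delta x^m}{2(2K-1)m!}\sum_{|\boldsymbol\alpha|=m}\frac{\frac1{\Delta y}\int_{y_{j-1/2}}^{y_{j+1/2}}|[\![\partial^{\boldsymbol\alpha}\mathbf U_h^{(q)}]\!]_{i+\frac12,j}|\,dy}{\|\mathbf U_h^{(q)}-\overline{\mathbf U}_\Omega^{(q)}\|_{L^\infty(\Omega)}},$$ $$\sigma^m_{i,j+\frac12}(\mathbf U_h^{(q)})=\frac{(2m+1)\Delta y^m}{2(2K-1)m!}\sum_{|\boldsymbol\alpha|=m}\frac{\frac1{\Delta x}\int_{x_{i-1/2}}^{x_{i+1/2}}|[\![\partial^{\boldsymbol\alpha}\mathbf U_h^{(q)}]\!]_{i,j+\frac12}|\,dx}{\|\mathbf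 U_h^{(q)}-\overline{\mathbf U}_\Omega^{(q)}\|_{L^\infty(\Omega)}},$$ with $[\![\cdot]\!]$ the jump across the edge. **Fully discrete OEDG method.** The system $\partial_t\mathbf U_h=\mathcal L_h(\mathbf U_h)$ is discretized in time by an SSP (strong-stability-preserving) Runge–Kutta scheme, i.e. one whose stages are convex combinations of forward Euler steps, and $\mathcal F_{\Delta t}$ is applied after each stage: $\mathbf U_\sigma^{n,0}=\mathbf U_\sigma^n:=\mathcal F_{\Delta t}\mathbf U_h^n$; for $r=1,\dots,s$, $$\mathbf U_h^{n,r}=\sum_{l=0}^{r-1}\left(c_{rl}\mathbf U_\sigma^{n,l}+\Delta t\,d_{rl}\,\mathcal L_h(\mathbf U_\sigma^{n,l})\right),\qquad \mathbf U_\sigma^{n,r}=\mathcal F_{\Delta t}\mathbf U_h^{n,r},$$ with $c_{rl}\ge0$, $d_{rl}\ge0$, $\sum_lc_{rl}=1$, and $d_{rl}=0$ whenever $c_{rl}=0$; and $\mathbf U_h^{n+1}=\mathbf U_h^{n,s}$.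
   Formalization: The English fixes no exterior traces on the boundary of Ω; the boundary treatment is assumed to continue data with velocity u_0 and pressure p_0 by such data (e.g. periodic), and ρ, 1/(γ-1), γ are assumed nonzero for all stage solutions so that u, p and L_h are defined. *)

theory Defs
  imports "HOL-Analysis.Analysis" "HOL-Computational_Algebra.Polynomial"
begin

section \<open>The five-equation transport model\<close>

text \<open>
  A state is \<open>U = (z1 rho1, z2 rho2, rho u, rho v, E, z1)\<close>, stored as a vector in \<open>real ^ 6\<close>
  (in the index type \<open>6\<close> the numeral 6 is another name for 0).
\<close>

type_synonym state = "real ^ 6"

record eos =
  gamma1 :: real
  gamma2 :: real
  pw1 :: real
  pw2 :: real

definition conserved :: "state \<Rightarrow> real ^ 5" where
  "conserved U = vector [U $ 1, U $ 2, U $ 3, U $ 4, U $ 5]"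

definition density :: "state \<Rightarrow> real" where
  "density U = U $ 1 + U $ 2"

definition velocity :: "state \<Rightarrow> real \<times> real" where
  "velocity U = (U $ 3 / density U, U $ 4 / density U)"

text \<open>The two mixture relations, giving \<open>1 / (\<gamma> - 1)\<close> and \<open>\<gamma> p\<^sub>w / (\<gamma> - 1)\<close>.\<close>

definition mix_Gamma :: "eos \<Rightarrow> state \<Rightarrow> real" where
  "mix_Gamma Q U = U $ 6 / (gamma1 Q - 1) + (1 - U $ 6) / (gamma2 Q - 1)"

definition mix_Pi :: "eos \<Rightarrow> state \<Rightarrow> real" where
  "mix_Pi Q U = U $ 6 * gamma1 Q * pw1 Q / (gamma1 Q - 1)
              + (1 - U $ 6) * gamma2 Q * pw2 Q / (gamma2 Q - 1)"

definition mix_gamma :: "eos \<Rightarrow> state \<Rightarrow> real" where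
  "mix_gamma Q U = 1 + 1 / mix_Gamma Q U"

definition mix_pw :: "eos \<Rightarrow> state \<Rightarrow> real" where
  "mix_pw Q U = mix_Pi Q U * (mix_gamma Q U - 1) / mix_gamma Q U"

definition pressure :: "eos \<Rightarrow> state \<Rightarrow> real" where
  "pressure Q U = (U $ 5 - 1 / 2 * density U * (norm (velocity U))\<^sup>2) * (mix_gamma Q U - 1)
                - mix_gamma Q U * mix_pw Q U"

definition sound_speed :: "eos \<Rightarrow> state \<Rightarrow> real" where
  "sound_speed Q U = sqrt (mix_gamma Q U * (pressure Q U + mix_pw Q U) / density U)"

text \<open>
  The states at which velocity, \<open>\<gamma>\<close>, \<open>p\<^sub>w\<close> and pressure are given by divisions with nonzero
  denominator. HOL division is total, so this has to be said explicitly; no sign of the density and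
  no bound on the volume fraction is imposed.
\<close>

definition well_defined :: "eos \<Rightarrow> state \<Rightarrow> bool" where
  "well_defined Q U \<longleftrightarrow> density U \<noteq> 0 \<and> mix_Gamma Q U \<noteq> 0 \<and> mix_gamma Q U \<noteq> 0"

definition flux1 :: "eos \<Rightarrow> state \<Rightarrow> real ^ 5" where
  "flux1 Q U = (let u = fst (velocity U); v = snd (velocity U); p = pressure Q U in
     vector [U $ 1 * u, U $ 2 * u, density U * u * u + p, density U * u * v, u * (U $ 5 + p)])"

definition flux2 :: "eos \<Rightarrow> state \<Rightarrow> real ^ 5" where
  "flux2 Q U = (let u = fst (velocity U); v = snd (velocity U); p = pressure Q U in
     vector [U $ 1 * v, U $ 2 * v, density U * u * v, density U * v * v + p, v * (U $ 5 + p)])"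

definition wave_speed1 :: "eos \<Rightarrow> state \<Rightarrow> state \<Rightarrow> real" where
  "wave_speed1 Q Um Up = max (\<bar>fst (velocity Up)\<bar> + sound_speed Q Up)
                             (\<bar>fst (velocity Um)\<bar> + sound_speed Q Um)"

definition wave_speed2 :: "eos \<Rightarrow> state \<Rightarrow> state \<Rightarrow> real" where
  "wave_speed2 Q Um Up = max (\<bar>snd (velocity Up)\<bar> + sound_speed Q Up)
                             (\<bar>snd (velocity Um)\<bar> + sound_speed Q Um)"

text \<open>
  Numerical fluxes. \<open>Um\<close> is the left/lower trace, \<open>Up\<close> the right/upper trace and \<open>Ui\<close> the trace
  from inside the current cell (so \<open>Ui\<close> is one of the two).
\<close>

definition num_flux1 :: "eos \<Rightarrow> state \<Rightarrow> state \<Rightarrow> real ^ 5" where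
  "num_flux1 Q Um Up = (1 / 2) *\<^sub>R (flux1 Q Up + flux1 Q Um)
     - (wave_speed1 Q Um Up / 2) *\<^sub>R (conserved Up - conserved Um)"

definition num_flux2 :: "eos \<Rightarrow> state \<Rightarrow> state \<Rightarrow> real ^ 5" where
  "num_flux2 Q Um Up = (1 / 2) *\<^sub>R (flux2 Q Up + flux2 Q Um)
     - (wave_speed2 Q Um Up / 2) *\<^sub>R (conserved Up - conserved Um)"

definition num_uz :: "eos \<Rightarrow> state \<Rightarrow> state \<Rightarrow> state \<Rightarrow> real" where
  "num_uz Q Ui Um Up = 1 / 2 * fst (velocity Ui) * (Um $ 6 + Up $ 6)
     - 1 / 2 * wave_speed1 Q Um Up * (Up $ 6 - Um $ 6)"

definition num_vz :: "eos \<Rightarrow> state \<Rightarrow> state \<Rightarrow> state \<Rightarrow> real" where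
  "num_vz Q Ui Um Up = 1 / 2 * snd (velocity Ui) * (Um $ 6 + Up $ 6)
     - 1 / 2 * wave_speed2 Q Um Up * (Up $ 6 - Um $ 6)"

section \<open>Mesh and discontinuous piecewise polynomials\<close>

text \<open>
  The domain is the rectangle with lower left corner \<open>(xmin, ymin)\<close> that is divided into
  \<open>nx \<times> ny\<close> cells of size \<open>hx \<times> hy\<close>. Cells are indexed by integers so that the same formulas
  also describe the ghost cells next to the boundary.
\<close>

record mesh =
  xmin :: real
  ymin :: real
  hx :: real
  hy :: real
  nx :: nat
  ny :: nat

definition valid_mesh :: "mesh \<Rightarrow> bool" where
  "valid_mesh M \<longleftrightarrow> hx M > 0 \<and> hy M > 0 \<and> nx M \<ge> 1 \<and> ny M \<ge> 1"

definition cells :: "mesh \<Rightarrow> (int \<times> int) set" where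
  "cells M = {0..<int (nx M)} \<times> {0..<int (ny M)}"

definition ghost_cells :: "mesh \<Rightarrow> (int \<times> int) set" where
  "ghost_cells M = {-1, int (nx M)} \<times> {0..<int (ny M)} \<union> {0..<int (nx M)} \<times> {-1, int (ny M)}"

text \<open>Cell \<open>i\<close> of the x-direction is \<open>[xe M i, xe M (i + 1)]\<close>; similarly for y.\<close>

definition xe :: "mesh \<Rightarrow> int \<Rightarrow> real" where
  "xe M i = xmin M + of_int i * hx M"

definition ye :: "mesh \<Rightarrow> int \<Rightarrow> real" where
  "ye M j = ymin M + of_int j * hy M"

definition cell :: "mesh \<Rightarrow> int \<Rightarrow> int \<Rightarrow> (real \<times> real) set" where
  "cell M i j = {xe M i..xe M (i + 1)} \<times> {ye M j..ye M (j + 1)}"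

text \<open>Legendre polynomials by Rodrigues' formula.\<close>

definition legendre :: "nat \<Rightarrow> real poly" where
  "legendre n = smult (1 / (2 ^ n * fact n)) ((pderiv ^^ n) ([:-1, 0, 1:] ^ n))"

definition basis :: "mesh \<Rightarrow> int \<Rightarrow> int \<Rightarrow> nat \<times> nat \<Rightarrow> real \<times> real \<Rightarrow> real" where
  "basis M i j \<alpha> = (\<lambda>(x, y).
     poly (legendre (fst \<alpha>)) (2 * (x - (xe M i + xe M (i + 1)) / 2) / hx M) *
     poly (legendre (snd \<alpha>)) (2 * (y - (ye M j + ye M (j + 1)) / 2) / hy M))"

definition modes :: "nat \<Rightarrow> (nat \<times> nat) set" where
  "modes K = {\<alpha>. fst \<alpha> + snd \<alpha> \<le> K}"

definition modes_eq :: "nat \<Rightarrow> (nat \<times> nat) set" where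
  "modes_eq m = {\<alpha>. fst \<alpha> + snd \<alpha> = m}"

text \<open>
  An element of the sixfold product of the space of piecewise polynomials of total degree at most
  \<open>K\<close> is given by its modal coefficients in the Legendre basis: \<open>U i j \<alpha>\<close> is the coefficient of
  \<open>basis M i j \<alpha>\<close> on cell \<open>(i, j)\<close>. Coefficients outside \<open>modes K\<close> are never used.
  \<open>dg_val M K U i j\<close> is the polynomial on cell \<open>(i, j)\<close>; its values on the boundary of the cell
  are the interior traces.
\<close>

type_synonym dof = "int \<Rightarrow> int \<Rightarrow> nat \<times> nat \<Rightarrow> state"

definition dg_val :: "mesh \<Rightarrow> nat \<Rightarrow> dof \<Rightarrow> int \<Rightarrow> int \<Rightarrow> real \<times> real \<Rightarrow> state" where
  "dg_val M K U i j p = (\<Sum>\<alpha>\<in>modes K. basis M i j \<alpha> p *\<^sub>R U i j \<alpha>)"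

definition partial_x :: "(real \<times> real \<Rightarrow> real) \<Rightarrow> real \<times> real \<Rightarrow> real" where
  "partial_x f = (\<lambda>(x, y). deriv (\<lambda>t. f (t, y)) x)"

definition partial_y :: "(real \<times> real \<Rightarrow> real) \<Rightarrow> real \<times> real \<Rightarrow> real" where
  "partial_y f = (\<lambda>(x, y). deriv (\<lambda>t. f (x, t)) y)"

definition partial :: "nat \<times> nat \<Rightarrow> (real \<times> real \<Rightarrow> real) \<Rightarrow> real \<times> real \<Rightarrow> real" where
  "partial \<alpha> f = (partial_x ^^ fst \<alpha>) ((partial_y ^^ snd \<alpha>) f)"

section \<open>Boundary conditions\<close>

text \<open>
  Fluxes and jumps on the edges lying on the boundary of the domain need exterior traces. They are
  supplied by a boundary treatment \<open>bc\<close> that fills the ghost cells from the numerical solution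
  and leaves the cells of the mesh unchanged.
\<close>

definition extends_mesh_data :: "mesh \<Rightarrow> (dof \<Rightarrow> dof) \<Rightarrow> bool" where
  "extends_mesh_data M bc \<longleftrightarrow> (\<forall>U. \<forall>(i, j)\<in>cells M. bc U i j = U i j)"

definition well_defined_on :: "eos \<Rightarrow> mesh \<Rightarrow> nat \<Rightarrow> (int \<times> int) set \<Rightarrow> dof \<Rightarrow> bool" where
  "well_defined_on Q M K A U \<longleftrightarrow>
     (\<forall>(i, j)\<in>A. \<forall>p\<in>cell M i j. well_defined Q (dg_val M K U i j p))"

definition velocity_is :: "mesh \<Rightarrow> nat \<Rightarrow> (int \<times> int) set \<Rightarrow> dof \<Rightarrow> real \<times> real \<Rightarrow> bool" where
  "velocity_is M K A U u0 \<longleftrightarrow>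
     (\<forall>(i, j)\<in>A. \<forall>p\<in>cell M i j. velocity (dg_val M K U i j p) = u0)"

definition pressure_is :: "eos \<Rightarrow> mesh \<Rightarrow> nat \<Rightarrow> (int \<times> int) set \<Rightarrow> dof \<Rightarrow> real \<Rightarrow> bool" where
  "pressure_is Q M K A U p0 \<longleftrightarrow>
     (\<forall>(i, j)\<in>A. \<forall>p\<in>cell M i j. pressure Q (dg_val M K U i j p) = p0)"

text \<open>
  The boundary treatment is compatible with the uniform flow \<open>(u0, p0)\<close> if it continues a numerical
  solution with this velocity and pressure by ghost data with the same velocity and pressure.
  Periodic conditions have this property (lemma \<open>periodic_bc_compatible\<close> below), and so do outflow
  conditions and inflow conditions prescribing \<open>u0\<close> and \<open>p0\<close>; a solid wall does not, unless \<open>u0\<close> is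
  tangential to it.
\<close>

definition bc_compatible ::
  "eos \<Rightarrow> mesh \<Rightarrow> nat \<Rightarrow> (dof \<Rightarrow> dof) \<Rightarrow> real \<times> real \<Rightarrow> real \<Rightarrow> bool" where
  "bc_compatible Q M K bc u0 p0 \<longleftrightarrow>
     (\<forall>U. well_defined_on Q M K (cells M) U \<and>
          velocity_is M K (cells M) U u0 \<and> pressure_is Q M K (cells M) U p0 \<longrightarrow>
          well_defined_on Q M K (ghost_cells M) (bc U) \<and>
          velocity_is M K (ghost_cells M) (bc U) u0 \<and> pressure_is Q M K (ghost_cells M) (bc U) p0)"

definition periodic_bc :: "mesh \<Rightarrow> dof \<Rightarrow> dof" where
  "periodic_bc M U = (\<lambda>i j. U (i mod int (nx M)) (j mod int (ny M)))"

section \<open>The semi-discrete operator\<close>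

text \<open>
  Integral over the boundary of cell \<open>(i, j)\<close> of the normal component of a field with x-component
  \<open>R\<close>, \<open>L\<close> on the right and left edge and y-component \<open>T\<close>, \<open>B\<close> on the upper and lower edge.
\<close>

definition boundary_integral :: "mesh \<Rightarrow> int \<Rightarrow> int \<Rightarrow>
  (real \<times> real \<Rightarrow> 'a::euclidean_space) \<Rightarrow> (real \<times> real \<Rightarrow> 'a) \<Rightarrow>
  (real \<times> real \<Rightarrow> 'a) \<Rightarrow> (real \<times> real \<Rightarrow> 'a) \<Rightarrow> 'a" where
  "boundary_integral M i j R L T B =
       integral {ye M j..ye M (j + 1)} (\<lambda>y. R (xe M (i + 1), y))
     - integral {ye M j..ye M (j + 1)} (\<lambda>y. L (xe M i, y))
     + integral {xe M i..xe M (i + 1)} (\<lambda>x. T (x, ye M (j + 1)))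
     - integral {xe M i..xe M (i + 1)} (\<lambda>x. B (x, ye M j))"

text \<open>\<open>dg_operator Q M K bc U V\<close>: \<open>V\<close> is the value of the semi-discrete operator at \<open>U\<close>.\<close>

definition dg_operator :: "eos \<Rightarrow> mesh \<Rightarrow> nat \<Rightarrow> (dof \<Rightarrow> dof) \<Rightarrow> dof \<Rightarrow> dof \<Rightarrow> bool" where
  "dg_operator Q M K bc U V \<longleftrightarrow> (\<forall>(i, j)\<in>cells M. \<forall>\<alpha>\<in>modes K.
     (let I = cell M i j;
          \<phi> = basis M i j \<alpha>;
          C = dg_val M K (bc U) i j;
          R = dg_val M K (bc U) (i + 1) j;
          L = dg_val M K (bc U) (i - 1) j;
          T = dg_val M K (bc U) i (j + 1);
          B = dg_val M K (bc U) i (j - 1);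
          u = (\<lambda>p. fst (velocity (C p)));
          v = (\<lambda>p. snd (velocity (C p)));
          z = (\<lambda>p. C p $ 6)
      in
        integral I (\<lambda>p. \<phi> p *\<^sub>R conserved (dg_val M K V i j p)) =
          integral I (\<lambda>p. partial_x \<phi> p *\<^sub>R flux1 Q (C p) + partial_y \<phi> p *\<^sub>R flux2 Q (C p))
          - boundary_integral M i j
              (\<lambda>p. \<phi> p *\<^sub>R num_flux1 Q (C p) (R p)) (\<lambda>p. \<phi> p *\<^sub>R num_flux1 Q (L p) (C p))
              (\<lambda>p. \<phi> p *\<^sub>R num_flux2 Q (C p) (T p)) (\<lambda>p. \<phi> p *\<^sub>R num_flux2 Q (B p) (C p))
        \<and>
        integral I (\<lambda>p. dg_val M K V i j p $ 6 * \<phi> p) =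
          - integral I (\<lambda>p. \<phi> p * (u p * partial_x z p + v p * partial_y z p))
          - boundary_integral M i j
              (\<lambda>p. \<phi> p * num_uz Q (C p) (C p) (R p)) (\<lambda>p. \<phi> p * num_uz Q (C p) (L p) (C p))
              (\<lambda>p. \<phi> p * num_vz Q (C p) (C p) (T p)) (\<lambda>p. \<phi> p * num_vz Q (C p) (B p) (C p))
          + boundary_integral M i j
              (\<lambda>p. \<phi> p * (u p * z p)) (\<lambda>p. \<phi> p * (u p * z p))
              (\<lambda>p. \<phi> p * (v p * z p)) (\<lambda>p. \<phi> p * (v p * z p))))"

section \<open>The oscillation-eliminating operator\<close>

definition domain_average :: "mesh \<Rightarrow> nat \<Rightarrow> dof \<Rightarrow> 6 \<Rightarrow> real" where
  "domain_average M K U q =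
     (\<Sum>(i, j)\<in>cells M. integral (cell M i j) (\<lambda>p. dg_val M K U i j p $ q))
     / ((real (nx M) * hx M) * (real (ny M) * hy M))"

text \<open>
  The \<open>L\<^sup>\<infinity>\<close> norm over the domain of the deviation from the average. The supremum of a piecewise
  polynomial over all closed cells is its essential supremum.
\<close>

definition deviation_sup :: "mesh \<Rightarrow> nat \<Rightarrow> dof \<Rightarrow> 6 \<Rightarrow> real" where
  "deviation_sup M K U q = Sup {\<bar>dg_val M K U i j p $ q - domain_average M K U q\<bar> | i j p.
     (i, j) \<in> cells M \<and> p \<in> cell M i j}"

definition is_constant :: "mesh \<Rightarrow> nat \<Rightarrow> dof \<Rightarrow> 6 \<Rightarrow> bool" where
  "is_constant M K U q \<longleftrightarrow>
     (\<forall>(i, j)\<in>cells M. \<forall>p\<in>cell M i j. dg_val M K U i j p $ q = domain_average M K U q)"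

text \<open>
  \<open>sigma_x \<dots> m q i j\<close> belongs to the edge between the cells \<open>(i - 1, j)\<close> and \<open>(i, j)\<close>, i.e. to
  the half-integer index \<open>(i - 1/2, j)\<close>; likewise \<open>sigma_y \<dots> m q i j\<close> belongs to \<open>(i, j - 1/2)\<close>.
\<close>

definition sigma_x ::
  "mesh \<Rightarrow> nat \<Rightarrow> (dof \<Rightarrow> dof) \<Rightarrow> dof \<Rightarrow> nat \<Rightarrow> 6 \<Rightarrow> int \<Rightarrow> int \<Rightarrow> real" where
  "sigma_x M K bc U m q i j =
     (if is_constant M K U q then 0
      else (2 * real m + 1) * hx M ^ m / (2 * (2 * real K - 1) * fact m) *
        (\<Sum>\<alpha>\<in>modes_eq m.
           (1 / hy M * integral {ye M j..ye M (j + 1)} (\<lambda>y.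
              \<bar>partial \<alpha> (\<lambda>p. dg_val M K (bc U) i j p $ q) (xe M i, y)
               - partial \<alpha> (\<lambda>p. dg_val M K (bc U) (i - 1) j p $ q) (xe M i, y)\<bar>))
           / deviation_sup M K U q))"

definition sigma_y ::
  "mesh \<Rightarrow> nat \<Rightarrow> (dof \<Rightarrow> dof) \<Rightarrow> dof \<Rightarrow> nat \<Rightarrow> 6 \<Rightarrow> int \<Rightarrow> int \<Rightarrow> real" where
  "sigma_y M K bc U m q i j =
     (if is_constant M K U q then 0
      else (2 * real m + 1) * hy M ^ m / (2 * (2 * real K - 1) * fact m) *
        (\<Sum>\<alpha>\<in>modes_eq m.
           (1 / hx M * integral {xe M i..xe M (i + 1)} (\<lambda>x.
              \<bar>partial \<alpha> (\<lambda>p. dg_val M K (bc U) i j p $ q) (x, ye M j)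
               - partial \<alpha> (\<lambda>p. dg_val M K (bc U) i (j - 1) p $ q) (x, ye M j)\<bar>))
           / deviation_sup M K U q))"

text \<open>
  \<open>\<beta>x\<close> and \<open>\<beta>y\<close> are the wave speed estimates; they may depend on the numerical solution and on
  the cell in any way.
\<close>

type_synonym speed_estimate = "dof \<Rightarrow> int \<Rightarrow> int \<Rightarrow> real"

definition damping :: "mesh \<Rightarrow> nat \<Rightarrow> (dof \<Rightarrow> dof) \<Rightarrow> speed_estimate \<Rightarrow> speed_estimate \<Rightarrow>
  dof \<Rightarrow> nat \<Rightarrow> int \<Rightarrow> int \<Rightarrow> real" where
  "damping M K bc \<beta>x \<beta>y U m i j = (MAX q\<in>(UNIV :: 6 set).
     \<beta>x U i j * (sigma_x M K bc U m q (i + 1) j + sigma_x M K bc U m q i j) / hx M +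
     \<beta>y U i j * (sigma_y M K bc U m q i (j + 1) + sigma_y M K bc U m q i j) / hy M)"

definition oe_operator :: "mesh \<Rightarrow> nat \<Rightarrow> (dof \<Rightarrow> dof) \<Rightarrow> speed_estimate \<Rightarrow> speed_estimate \<Rightarrow>
  real \<Rightarrow> dof \<Rightarrow> dof" where
  "oe_operator M K bc \<beta>x \<beta>y \<Delta>t U = (\<lambda>i j \<alpha>.
     (let k = fst \<alpha> + snd \<alpha> in
      if k = 0 then U i j \<alpha>
      else exp (- \<Delta>t * (\<Sum>m=0..k. damping M K bc \<beta>x \<beta>y U m i j)) *\<^sub>R U i j \<alpha>))"

section \<open>The fully discrete method\<close>

record rk_scheme =
  stages :: nat
  rk_c :: "nat \<Rightarrow> nat \<Rightarrow> real"
  rk_d :: "nat \<Rightarrow> nat \<Rightarrow> real"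

definition ssp :: "rk_scheme \<Rightarrow> bool" where
  "ssp S \<longleftrightarrow> stages S \<ge> 1 \<and>
     (\<forall>r\<in>{1..stages S}.
        (\<forall>l<r. rk_c S r l \<ge> 0 \<and> rk_d S r l \<ge> 0 \<and> (rk_c S r l = 0 \<longrightarrow> rk_d S r l = 0)) \<and>
        (\<Sum>l<r. rk_c S r l) = 1)"

text \<open>
  One time step from \<open>U0\<close> to \<open>U1\<close>, with stages \<open>Uh r\<close> before and \<open>Us r\<close> after the application of
  the oscillation-eliminating operator; \<open>V l\<close> is the semi-discrete operator at \<open>Us l\<close>.
\<close>

definition oedg_step :: "eos \<Rightarrow> mesh \<Rightarrow> nat \<Rightarrow> (dof \<Rightarrow> dof) \<Rightarrow> speed_estimate \<Rightarrow> speed_estimate \<Rightarrow>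
  rk_scheme \<Rightarrow> real \<Rightarrow> dof \<Rightarrow> (nat \<Rightarrow> dof) \<Rightarrow> (nat \<Rightarrow> dof) \<Rightarrow> dof \<Rightarrow> bool" where
  "oedg_step Q M K bc \<beta>x \<beta>y S \<Delta>t U0 Uh Us U1 \<longleftrightarrow>
     Us 0 = oe_operator M K bc \<beta>x \<beta>y \<Delta>t U0 \<and>
     (\<exists>V. (\<forall>l<stages S. dg_operator Q M K bc (Us l) (V l)) \<and>
          (\<forall>r\<in>{1..stages S}.
             Uh r = (\<lambda>i j \<alpha>. \<Sum>l<r.
               (rk_c S r l *\<^sub>R Us l i j \<alpha> + (\<Delta>t * rk_d S r l) *\<^sub>R V l i j \<alpha>)) \<and>
             Us r = oe_operator M K bc \<beta>x \<beta>y \<Delta>t (Uh r))) \<and>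
     U1 = Uh (stages S)"

section \<open>Periodic boundary conditions are admissible\<close>

lemma periodic_bc_extends: "extends_mesh_data M (periodic_bc M)"
  by (auto simp: extends_mesh_data_def periodic_bc_def cells_def)

lemma dg_val_periodic:
  "dg_val M K (periodic_bc M U) i j (x, y) =
   dg_val M K U (i mod int (nx M)) (j mod int (ny M))
     (x - of_int (i - i mod int (nx M)) * hx M, y - of_int (j - j mod int (ny M)) * hy M)"
proof -
  have "basis M i j \<alpha> (x, y) = basis M (i mod int (nx M)) (j mod int (ny M)) \<alpha>
     (x - of_int (i - i mod int (nx M)) * hx M, y - of_int (j - j mod int (ny M)) * hy M)" for \<alpha>
    by (simp add: basis_def xe_def ye_def algebra_simps add_divide_distrib)
  then show ?thesis
    by (simp add: dg_val_def periodic_bc_def)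
qed

lemma periodic_bc_compatible:
  assumes "valid_mesh M"
  shows "bc_compatible Q M K (periodic_bc M) u0 p0"
proof -
  have *: "\<exists>i' j' p'. (i', j') \<in> cells M \<and> p' \<in> cell M i' j' \<and>
      dg_val M K (periodic_bc M U) i j p = dg_val M K U i' j' p'"
    if "p \<in> cell M i j" for U i j p
  proof -
    obtain x y where p: "p = (x, y)" by (cases p)
    define i' where "i' = i mod int (nx M)"
    define j' where "j' = j mod int (ny M)"
    have "(i', j') \<in> cells M"
      using assms by (simp add: i'_def j'_def cells_def valid_mesh_def)
    moreover have "(x - of_int (i - i') * hx M, y - of_int (j - j') * hy M) \<in> cell M i' j'"
      using that by (simp add: p cell_def xe_def ye_def algebra_simps)
    ultimately show ?thesis
      using dg_val_periodic[of M K U i j x y] unfolding p i'_def j'_def by blast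
  qed
  have transfer: "P (dg_val M K (periodic_bc M U) i j p)"
    if "\<forall>(i, j)\<in>cells M. \<forall>p\<in>cell M i j. P (dg_val M K U i j p)" "p \<in> cell M i j" for P U i j p
    using *[OF that(2), of U] that(1) by force
  show ?thesis
    unfolding bc_compatible_def well_defined_on_def velocity_is_def pressure_is_def
    using transfer[where P = "well_defined Q"] transfer[where P = "\<lambda>U. velocity U = u0"]
      transfer[where P = "\<lambda>U. pressure Q U = p0"]
    by blast
qed

end

theory Submission
  imports Defs
begin

text \<open>
  At states with velocity \<open>u0\<close> and pressure \<open>p0\<close>, momentum and energy are affine functions of the
  partial densities and of \<open>z1\<close>; so uniformity of a piecewise polynomial is a system of linear
  equations for its modal coefficients, homogeneous in the modes of positive degree. Damping these
  modes and taking convex combinations preserve such equations. It remains to see that the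
  semi-discrete operator maps uniform data into the solutions of the homogeneous system. The
  numerical fluxes of \<open>\<rho> u - u0 \<rho>\<close> are constants, and those of \<open>E - \<rho> |u0|\<^sup>2 / 2\<close> are, up to
  constants, a constant multiple of the numerical flux of \<open>z1\<close>. In both cases Green's formula on the cell
  shows that the conservative discretization and the quasi-conservative discretization of the \<open>z1\<close>
  equation cancel when tested with any basis function.
\<close>

section \<open>Uniform states as an affine subspace\<close>

lemma vector_5:
  "(vector [a, b, c, d, e] :: 'a::zero ^ 5) $ 1 = a"
  "(vector [a, b, c, d, e] :: 'a::zero ^ 5) $ 2 = b"
  "(vector [a, b, c, d, e] :: 'a::zero ^ 5) $ 3 = c"
  "(vector [a, b, c, d, e] :: 'a::zero ^ 5) $ 4 = d"
  "(vector [a, b, c, d, e] :: 'a::zero ^ 5) $ 5 = e"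
  unfolding vector_def by simp_all

lemma forall_5: "(\<forall>i::5. P i) \<longleftrightarrow> P 1 \<and> P 2 \<and> P 3 \<and> P 4 \<and> P 5"
proof -
  have "x = 1 \<or> x = 2 \<or> x = 3 \<or> x = 4 \<or> x = 5" for x :: 5
  proof (induct x)
    case (of_int z)
    then have "z = 0 \<or> z = 1 \<or> z = 2 \<or> z = 3 \<or> z = 4" by fastforce
    then show ?case by auto
  qed
  then show ?thesis by metis
qed

lemma continuous_on_vector_5 [continuous_intros]:
  fixes a b c d e :: "'b::topological_space \<Rightarrow> real"
  assumes "continuous_on A a" "continuous_on A b" "continuous_on A c" "continuous_on A d"
    "continuous_on A e"
  shows "continuous_on A (\<lambda>x. vector [a x, b x, c x, d x, e x] :: real ^ 5)"
proof -
  have "\<forall>i::5. continuous_on A (\<lambda>x. (vector [a x, b x, c x, d x, e x] :: real ^ 5) $ i)"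
    using assms by (simp add: forall_5 vector_5)
  then have "continuous_on A (\<lambda>x. \<chi> i. (vector [a x, b x, c x, d x, e x] :: real ^ 5) $ i)"
    by (intro continuous_on_vec_lambda) blast
  then show ?thesis
    by (simp add: vec_nth_inverse)
qed

lemma linear_conserved: "linear conserved"
  by (rule linearI) (simp_all add: conserved_def vec_eq_iff forall_5 vector_5)

text \<open>\<open>well_defined\<close> is included because prescribed velocity and pressure are
  equivalent to affine equations only once the denominators are known to be nonzero.\<close>

definition uniform_state :: "eos \<Rightarrow> real \<times> real \<Rightarrow> real \<Rightarrow> state \<Rightarrow> bool" where
  "uniform_state Q u0 p0 U \<longleftrightarrow> well_defined Q U \<and> velocity U = u0 \<and> pressure Q U = p0"

text \<open>
  At a uniform state, \<open>E\<close> is \<open>\<rho> |u0|\<^sup>2 / 2 + p0 / (\<gamma> - 1) + \<gamma> p\<^sub>w / (\<gamma> - 1)\<close>, where the last two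
  summands are an affine function of \<open>z1\<close>; the following are its slope and its constant term.
\<close>

definition energy_slope :: "eos \<Rightarrow> real \<Rightarrow> real" where
  "energy_slope Q p0 = (p0 + gamma1 Q * pw1 Q) / (gamma1 Q - 1)
     - (p0 + gamma2 Q * pw2 Q) / (gamma2 Q - 1)"

definition energy_offset :: "eos \<Rightarrow> real \<Rightarrow> real" where
  "energy_offset Q p0 = (p0 + gamma2 Q * pw2 Q) / (gamma2 Q - 1)"

text \<open>This functional and the next two live on \<open>real ^ 5\<close>, so that they apply to
  conserved variables and to fluxes alike. Freezing the velocity at \<open>u0\<close> makes them
  linear; the third one is the total energy minus the kinetic energy at velocity
  \<open>u0\<close>.\<close>

definition excess_momentum1 :: "real \<times> real \<Rightarrow> real ^ 5 \<Rightarrow> real" where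
  "excess_momentum1 u0 W = W $ 3 - fst u0 * (W $ 1 + W $ 2)"

definition excess_momentum2 :: "real \<times> real \<Rightarrow> real ^ 5 \<Rightarrow> real" where
  "excess_momentum2 u0 W = W $ 4 - snd u0 * (W $ 1 + W $ 2)"

definition internal_energy :: "real \<times> real \<Rightarrow> real ^ 5 \<Rightarrow> real" where
  "internal_energy u0 W = W $ 5 - (norm u0)\<^sup>2 / 2 * (W $ 1 + W $ 2)"

text \<open>Both mixture quantities are affine in the volume fraction; collecting coefficients gives
  the slope and the offset.\<close>

lemma mix_energy_eq:
  "p0 * mix_Gamma Q U + mix_Pi Q U = energy_slope Q p0 * U $ 6 + energy_offset Q p0"
  by (simp add: mix_Gamma_def mix_Pi_def energy_slope_def energy_offset_def diff_divide_distrib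
      add_divide_distrib algebra_simps)

text \<open>Clearing nonzero denominators makes the rational conditions affine. The pressure is
  treated only after the velocity is known to be \<open>u0\<close>, since the kinetic energy is then
  linear in the density.\<close>

lemma uniform_state_iff:
  "uniform_state Q u0 p0 U \<longleftrightarrow> well_defined Q U \<and>
     excess_momentum1 u0 (conserved U) = 0 \<and> excess_momentum2 u0 (conserved U) = 0 \<and>
     internal_energy u0 (conserved U) = energy_slope Q p0 * U $ 6 + energy_offset Q p0"
proof (cases "well_defined Q U")
  case True
  then have d: "density U \<noteq> 0" and G: "mix_Gamma Q U \<noteq> 0" and g: "mix_gamma Q U \<noteq> 0"
    by (auto simp: well_defined_def)
  have vel: "velocity U = u0 \<longleftrightarrow>
      excess_momentum1 u0 (conserved U) = 0 \<and> excess_momentum2 u0 (conserved U) = 0"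
    using d by (cases u0) (auto simp: velocity_def excess_momentum1_def excess_momentum2_def
        conserved_def vector_5 density_def divide_simps)
  have pres: "pressure Q U = p0 \<longleftrightarrow>
      internal_energy u0 (conserved U) = energy_slope Q p0 * U $ 6 + energy_offset Q p0"
    if "velocity U = u0"
  proof -
    \<comment> \<open>Uses \<open>mix_gamma * mix_pw = mix_Pi * (mix_gamma - 1)\<close> and
      \<open>mix_gamma - 1 = 1 / mix_Gamma\<close>.\<close>
    have "pressure Q U = (internal_energy u0 (conserved U) - mix_Pi Q U) / mix_Gamma Q U"
      using g that by (simp add: pressure_def mix_pw_def internal_energy_def conserved_def vector_5
          density_def) (simp add: mix_gamma_def diff_divide_distrib add_divide_distrib algebra_simps)
    then have "pressure Q U = p0 \<longleftrightarrow>
        internal_energy u0 (conserved U) = p0 * mix_Gamma Q U + mix_Pi Q U"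
      using G by (auto simp: divide_simps)
    then show ?thesis
      by (simp add: mix_energy_eq)
  qed
  show ?thesis
    using True vel pres by (auto simp: uniform_state_def)
qed (simp add: uniform_state_def)

text \<open>
  The common form of the two momentum equations (\<open>\<kappa> = 0\<close>) and of the energy equation. The fluxes are
  only prescribed up to constants, which have no divergence.
\<close>

definition transported :: "eos \<Rightarrow> real \<times> real \<Rightarrow> real \<Rightarrow> (real ^ 5 \<Rightarrow> real) \<Rightarrow> real \<Rightarrow> real \<Rightarrow> bool" where
  "transported Q u0 p0 m \<kappa> c \<longleftrightarrow> bounded_linear m \<and>
     (\<forall>U. uniform_state Q u0 p0 U \<longrightarrow> m (conserved U) = \<kappa> * U $ 6 + c) \<and>
     (\<exists>d. \<forall>U. uniform_state Q u0 p0 U \<longrightarrow> m (flux1 Q U) = fst u0 * \<kappa> * U $ 6 + d) \<and>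
     (\<exists>d. \<forall>U. uniform_state Q u0 p0 U \<longrightarrow> m (flux2 Q U) = snd u0 * \<kappa> * U $ 6 + d)"

text \<open>The advective momentum flux cancels against the velocity times the mass flux. Only the
  pressure survives, so the flux constants are \<open>p0\<close> in the x-direction and 0 in the
  y-direction.\<close>

lemma transported_excess_momentum1: "transported Q u0 p0 (excess_momentum1 u0) 0 0"
proof -
  have "bounded_linear (excess_momentum1 u0)"
    unfolding excess_momentum1_def
    by (intro linear_conv_bounded_linear[THEN iffD1] linearI) (simp_all add: algebra_simps)
  moreover have "excess_momentum1 u0 (flux1 Q U) = p0" "excess_momentum1 u0 (flux2 Q U) = 0"
    if "uniform_state Q u0 p0 U" for U
    using that by (simp_all add: uniform_state_def excess_momentum1_def flux1_def flux2_def
        vector_5 Let_def density_def algebra_simps)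
  ultimately show ?thesis
    by (simp add: transported_def uniform_state_iff)
qed

lemma transported_excess_momentum2: "transported Q u0 p0 (excess_momentum2 u0) 0 0"
proof -
  have "bounded_linear (excess_momentum2 u0)"
    unfolding excess_momentum2_def
    by (intro linear_conv_bounded_linear[THEN iffD1] linearI) (simp_all add: algebra_simps)
  moreover have "excess_momentum2 u0 (flux1 Q U) = 0" "excess_momentum2 u0 (flux2 Q U) = p0"
    if "uniform_state Q u0 p0 U" for U
    using that by (simp_all add: uniform_state_def excess_momentum2_def flux1_def flux2_def
        vector_5 Let_def density_def algebra_simps)
  ultimately show ?thesis
    by (simp add: transported_def uniform_state_iff)
qed

text \<open>Subtracting the kinetic part from the energy flux leaves velocity times internal energy
  plus \<open>p0\<close>. This is affine in the volume fraction because the internal energy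
  is.\<close>

lemma transported_internal_energy:
  "transported Q u0 p0 (internal_energy u0) (energy_slope Q p0) (energy_offset Q p0)"
  unfolding transported_def
proof (intro conjI allI impI)
  show "bounded_linear (internal_energy u0)"
    unfolding internal_energy_def
    by (intro linear_conv_bounded_linear[THEN iffD1] linearI)
       (simp_all add: algebra_simps add_divide_distrib)
  show m: "internal_energy u0 (conserved U) = energy_slope Q p0 * U $ 6 + energy_offset Q p0"
    if "uniform_state Q u0 p0 U" for U
    using that by (simp add: uniform_state_iff)
  have "internal_energy u0 (flux1 Q U) = fst u0 * (internal_energy u0 (conserved U) + p0)"
       "internal_energy u0 (flux2 Q U) = snd u0 * (internal_energy u0 (conserved U) + p0)"
    if "uniform_state Q u0 p0 U" for U
    using that by (simp_all add: uniform_state_def internal_energy_def flux1_def flux2_def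
        conserved_def vector_5 Let_def algebra_simps)
  then show "\<exists>d. \<forall>U. uniform_state Q u0 p0 U \<longrightarrow>
        internal_energy u0 (flux1 Q U) = fst u0 * energy_slope Q p0 * U $ 6 + d"
      "\<exists>d. \<forall>U. uniform_state Q u0 p0 U \<longrightarrow>
        internal_energy u0 (flux2 Q U) = snd u0 * energy_slope Q p0 * U $ 6 + d"
    using m by (auto simp: algebra_simps)
qed

text \<open>The Lax-Friedrichs dissipation acts on \<open>m\<close> as \<open>\<kappa>\<close> times the dissipation of \<open>z1\<close>.\<close>

lemma transported_num_flux:
  assumes "transported Q u0 p0 m \<kappa> c"
  obtains d1 d2 where
    "\<And>U. uniform_state Q u0 p0 U \<Longrightarrow> m (flux1 Q U) = fst u0 * \<kappa> * U $ 6 + d1"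
    "\<And>U. uniform_state Q u0 p0 U \<Longrightarrow> m (flux2 Q U) = snd u0 * \<kappa> * U $ 6 + d2"
    "\<And>Ui Um Up. velocity Ui = u0 \<Longrightarrow> uniform_state Q u0 p0 Um \<Longrightarrow> uniform_state Q u0 p0 Up \<Longrightarrow>
       m (num_flux1 Q Um Up) = \<kappa> * num_uz Q Ui Um Up + d1"
    "\<And>Ui Um Up. velocity Ui = u0 \<Longrightarrow> uniform_state Q u0 p0 Um \<Longrightarrow> uniform_state Q u0 p0 Up \<Longrightarrow>
       m (num_flux2 Q Um Up) = \<kappa> * num_vz Q Ui Um Up + d2"
proof -
  interpret m: bounded_linear m
    using assms by (simp add: transported_def)
  have cons: "m (conserved U) = \<kappa> * U $ 6 + c" if "uniform_state Q u0 p0 U" for U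
    using assms that by (simp add: transported_def)
  obtain d1 d2 where
    d1: "\<And>U. uniform_state Q u0 p0 U \<Longrightarrow> m (flux1 Q U) = fst u0 * \<kappa> * U $ 6 + d1" and
    d2: "\<And>U. uniform_state Q u0 p0 U \<Longrightarrow> m (flux2 Q U) = snd u0 * \<kappa> * U $ 6 + d2"
    using assms unfolding transported_def by blast
  \<comment> \<open>Averaging the two flux traces keeps the constants \<open>d1\<close> and
    \<open>d2\<close>, while \<open>c\<close> cancels in the jump of the conserved variables. The
    same wave speed multiplies both jumps, and of \<open>Ui\<close> only the velocity
    enters.\<close>
  show thesis
    by (rule that[of d1 d2])
       (simp_all add: num_flux1_def num_flux2_def num_uz_def num_vz_def m.diff m.add m.scaleR
         d1 d2 cons algebra_simps)
qed

section \<open>Continuity of the numerical fluxes\<close>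

lemma continuous_on_conserved:
  "continuous_on A C \<Longrightarrow> continuous_on A (\<lambda>x. conserved (C x))"
  unfolding conserved_def by (intro continuous_intros)

text \<open>Continuity supplies the integrability that is needed to split integrals and to move
  linear functionals through them. It holds where the denominators of the state functions do not
  vanish.\<close>

context
  fixes Q :: eos and A :: "'b::topological_space set" and C :: "'b \<Rightarrow> state"
  assumes cont: "continuous_on A C" and wd: "\<And>x. x \<in> A \<Longrightarrow> well_defined Q (C x)"
begin

lemma continuous_on_density: "continuous_on A (\<lambda>x. density (C x))"
  unfolding density_def by (intro continuous_intros cont)

lemma continuous_on_velocity: "continuous_on A (\<lambda>x. velocity (C x))"
  unfolding velocity_def using wd
  by (intro continuous_intros continuous_on_density cont) (auto simp: well_defined_def)

lemma continuous_on_mix_gamma: "continuous_on A (\<lambda>x. mix_gamma Q (C x))"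
proof -
  have "continuous_on A (\<lambda>x. mix_Gamma Q (C x))"
    \<comment> \<open>As multiplication by a constant inverse, the division by
      \<open>gamma1 Q - 1\<close> or \<open>gamma2 Q - 1\<close> raises no side condition.\<close>
    unfolding mix_Gamma_def divide_inverse by (intro continuous_intros cont)
  then show ?thesis
    unfolding mix_gamma_def using wd by (intro continuous_intros) (auto simp: well_defined_def)
qed

lemma continuous_on_mix_pw: "continuous_on A (\<lambda>x. mix_pw Q (C x))"
proof -
  have "continuous_on A (\<lambda>x. mix_Pi Q (C x))"
    unfolding mix_Pi_def divide_inverse by (intro continuous_intros cont)
  then show ?thesis
    unfolding mix_pw_def using wd
    by (intro continuous_intros continuous_on_mix_gamma) (auto simp: well_defined_def)
qed

lemma continuous_on_pressure: "continuous_on A (\<lambda>x. pressure Q (C x))"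
  unfolding pressure_def
  by (intro continuous_intros cont continuous_on_density continuous_on_velocity
      continuous_on_mix_gamma continuous_on_mix_pw)

lemma continuous_on_sound_speed: "continuous_on A (\<lambda>x. sound_speed Q (C x))"
  \<comment> \<open>The real \<open>sqrt\<close> is extended as an odd function and is continuous
    everywhere, so the sign of the radicand is immaterial.\<close>
  unfolding sound_speed_def using wd
  by (intro continuous_intros continuous_on_density continuous_on_mix_gamma continuous_on_mix_pw
      continuous_on_pressure) (auto simp: well_defined_def)

lemma continuous_on_flux1: "continuous_on A (\<lambda>x. flux1 Q (C x))"
  unfolding flux1_def Let_def
  by (intro continuous_intros cont continuous_on_density continuous_on_velocity
      continuous_on_pressure)

lemma continuous_on_flux2: "continuous_on A (\<lambda>x. flux2 Q (C x))"
  unfolding flux2_def Let_def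
  by (intro continuous_intros cont continuous_on_density continuous_on_velocity
      continuous_on_pressure)

end

context
  fixes Q :: eos and A :: "'b::topological_space set" and C D :: "'b \<Rightarrow> state"
  assumes contC: "continuous_on A C" and wdC: "\<And>x. x \<in> A \<Longrightarrow> well_defined Q (C x)"
    and contD: "continuous_on A D" and wdD: "\<And>x. x \<in> A \<Longrightarrow> well_defined Q (D x)"
begin

lemmas flux_continuous_intros = continuous_intros
  contC continuous_on_conserved[OF contC] continuous_on_velocity[where Q = Q, OF contC wdC]
  continuous_on_sound_speed[where Q = Q, OF contC wdC] continuous_on_flux1[where Q = Q, OF contC wdC]
  continuous_on_flux2[where Q = Q, OF contC wdC]
  contD continuous_on_conserved[OF contD] continuous_on_velocity[where Q = Q, OF contD wdD]
  continuous_on_sound_speed[where Q = Q, OF contD wdD] continuous_on_flux1[where Q = Q, OF contD wdD]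
  continuous_on_flux2[where Q = Q, OF contD wdD]

lemma continuous_on_num_flux1: "continuous_on A (\<lambda>x. num_flux1 Q (C x) (D x))"
  unfolding num_flux1_def wave_speed1_def divide_inverse
  by (intro flux_continuous_intros)

lemma continuous_on_num_flux2: "continuous_on A (\<lambda>x. num_flux2 Q (C x) (D x))"
  unfolding num_flux2_def wave_speed2_def divide_inverse
  by (intro flux_continuous_intros)

lemma continuous_on_num_uz:
  "continuous_on A (\<lambda>x. velocity (Ui x)) \<Longrightarrow>
    continuous_on A (\<lambda>x. num_uz Q (Ui x) (C x) (D x))"
  unfolding num_uz_def wave_speed1_def divide_inverse
  by (intro flux_continuous_intros)

lemma continuous_on_num_vz:
  "continuous_on A (\<lambda>x. velocity (Ui x)) \<Longrightarrow>
    continuous_on A (\<lambda>x. num_vz Q (Ui x) (C x) (D x))"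
  unfolding num_vz_def wave_speed2_def divide_inverse
  by (intro flux_continuous_intros)

end

section \<open>Linear independence of the Legendre basis\<close>

lemma degree_pderiv_power:
  fixes p :: "'a::{comm_semiring_1,semiring_no_zero_divisors,semiring_char_0} poly"
  shows "degree ((pderiv ^^ k) p) = degree p - k"
  by (induction k) (simp_all add: degree_pderiv)

text \<open>In Rodrigues' formula, \<open>n\<close> derivatives lower the degree from
  \<open>2 * n\<close> to \<open>n\<close>.\<close>

lemma degree_legendre: "degree (legendre n) = n"
  by (simp add: legendre_def degree_pderiv_power degree_power_eq)

lemma legendre_0: "legendre 0 = 1"
  by (simp add: legendre_def one_pCons)

lemma legendre_nonzero: "legendre n \<noteq> 0"
  using degree_legendre[of n] by (cases n) (auto simp: legendre_0)

text \<open>Triangularity: the coefficient of highest degree comes from the last summand alone, so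
  its factor vanishes and induction handles the rest.\<close>

lemma sum_smult_independent:
  fixes P :: "nat \<Rightarrow> 'a::idom poly"
  assumes "\<And>n. degree (P n) = n" "\<And>n. P n \<noteq> 0" "(\<Sum>n\<le>N. smult (c n) (P n)) = 0" "n \<le> N"
  shows "c n = 0"
  using assms(3,4)
proof (induction N)
  case 0
  then show ?case using assms(2) by auto
next
  case (Suc N)
  have "coeff (\<Sum>n\<le>Suc N. smult (c n) (P n)) (Suc N) = c (Suc N) * lead_coeff (P (Suc N))"
    using assms(1) by (simp add: coeff_sum coeff_eq_0)
  then have "c (Suc N) = 0"
    using Suc.prems(1) assms(2) by (metis coeff_0 leading_coeff_0_iff mult_eq_0_iff)
  with Suc show ?case
    by (cases "n = Suc N") auto
qed

text \<open>The rescaling maps the interval onto \<open>{-1..1}\<close>, which would be an infinite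
  set of roots.\<close>

lemma poly_zero_on_interval:
  fixes p :: "real poly"
  assumes "h > 0" "\<And>x. x \<in> {l..l + h} \<Longrightarrow> poly p (2 * (x - (l + (l + h)) / 2) / h) = 0"
  shows "p = 0"
proof (rule ccontr)
  assume "p \<noteq> 0"
  have "{-1..1} \<subseteq> {t. poly p t = 0}"
  proof
    fix t :: real assume "t \<in> {-1..1}"
    then have "h * t \<le> h" "- h \<le> h * t"
      using assms(1) mult_left_mono[of t 1 h] mult_left_mono[of "-1" t h] by auto
    \<comment> \<open>This point is the preimage of \<open>t\<close> under the rescaling.\<close>
    then have "l + h / 2 * (t + 1) \<in> {l..l + h}"
      by (simp add: algebra_simps)
    then show "t \<in> {t. poly p t = 0}"
      using assms(2)[of "l + h / 2 * (t + 1)"] assms(1) by (simp add: field_simps)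
  qed
  moreover have "infinite {-1..1::real}"
    by (simp add: infinite_Icc)
  ultimately show False
    using poly_roots_finite[OF \<open>p \<noteq> 0\<close>] finite_subset by blast
qed

lemma finite_modes [simp]: "finite (modes K)"
proof -
  have "modes K \<subseteq> {..K} \<times> {..K}" by (auto simp: modes_def)
  then show ?thesis using finite_subset by blast
qed

text \<open>Separation of variables: for fixed \<open>y\<close> the sum is a polynomial in
  \<open>x\<close>, so its Legendre coefficients vanish; these are in turn Legendre sums in
  \<open>y\<close>.\<close>

lemma basis_independent:
  assumes "valid_mesh M" "\<And>p. p \<in> cell M i j \<Longrightarrow> (\<Sum>\<alpha>\<in>modes K. basis M i j \<alpha> p * c \<alpha>) = 0"
    "\<alpha> \<in> modes K"
  shows "c \<alpha> = 0"
proof -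
  \<comment> \<open>Extending the coefficients by zero from the triangle \<open>modes K\<close> to
    the full square of degrees lets the double sum be iterated.\<close>
  define d where "d m n = (if (m, n) \<in> modes K then c (m, n) else 0)" for m n
  let ?L = legendre
  let ?s = "\<lambda>x. 2 * (x - (xe M i + xe M (i + 1)) / 2) / hx M"
  let ?t = "\<lambda>y. 2 * (y - (ye M j + ye M (j + 1)) / 2) / hy M"
  have pos: "hx M > 0" "hy M > 0" using assms(1) by (auto simp: valid_mesh_def)
  have steps: "xe M (i + 1) = xe M i + hx M" "ye M (j + 1) = ye M j + hy M"
    by (simp_all add: xe_def ye_def algebra_simps)
  have sum: "(\<Sum>\<alpha>\<in>modes K. basis M i j \<alpha> (x, y) * c \<alpha>) =
      (\<Sum>m\<le>K. (\<Sum>n\<le>K. d m n * poly (?L n) (?t y)) * poly (?L m) (?s x))" for x y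
  proof -
    have "(\<Sum>\<alpha>\<in>modes K. basis M i j \<alpha> (x, y) * c \<alpha>) =
        (\<Sum>(m, n)\<in>{..K} \<times> {..K}. d m n * poly (?L n) (?t y) * poly (?L m) (?s x))"
      by (rule sum.mono_neutral_cong_left) (auto simp: modes_def d_def basis_def split: if_splits)
    then show ?thesis
      by (simp add: sum.cartesian_product sum_distrib_right)
  qed
  have *: "(\<Sum>n\<le>K. d m n * poly (?L n) (?t y)) = 0"
    if y: "y \<in> {ye M j..ye M (j + 1)}" and "m \<le> K" for m y
  proof (rule sum_smult_independent[OF degree_legendre legendre_nonzero _ \<open>m \<le> K\<close>],
      rule poly_zero_on_interval[OF pos(1)])
    fix x assume "x \<in> {xe M i..xe M i + hx M}"
    then have "(x, y) \<in> cell M i j"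
      using y by (simp add: cell_def steps)
    then show "poly (\<Sum>m\<le>K. smult (\<Sum>n\<le>K. d m n * poly (?L n) (?t y)) (?L m))
        (2 * (x - (xe M i + (xe M i + hx M)) / 2) / hx M) = 0"
      using sum[of x y] assms(2)[of "(x, y)"] by (simp only: poly_sum poly_smult steps)
  qed
  have "d m n = 0" if "m \<le> K" "n \<le> K" for m n
  proof (rule sum_smult_independent[OF degree_legendre legendre_nonzero _ \<open>n \<le> K\<close>],
      rule poly_zero_on_interval[OF pos(2)])
    fix y assume "y \<in> {ye M j..ye M j + hy M}"
    then show "poly (\<Sum>n\<le>K. smult (d m n) (?L n)) (2 * (y - (ye M j + (ye M j + hy M)) / 2) / hy M) = 0"
      using *[of y m] \<open>m \<le> K\<close> by (simp only: poly_sum poly_smult steps)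
  qed
  from this[of "fst \<alpha>" "snd \<alpha>"] assms(3) show ?thesis
    by (auto simp: d_def modes_def)
qed

section \<open>Green's formula on a cell\<close>

text \<open>The whole plane is the domain because each cell polynomial is globally defined;
  derivatives at cell boundaries are then two-sided. Differentiability is stated explicitly since
  \<open>deriv\<close> is total.\<close>

definition C1 :: "(real \<times> real \<Rightarrow> real) \<Rightarrow> bool" where
  "C1 f \<longleftrightarrow> continuous_on UNIV f \<and> continuous_on UNIV (partial_x f) \<and>
     continuous_on UNIV (partial_y f) \<and>
     (\<forall>x y. ((\<lambda>t. f (t, y)) has_real_derivative partial_x f (x, y)) (at x)) \<and>
     (\<forall>x y. ((\<lambda>t. f (x, t)) has_real_derivative partial_y f (x, y)) (at y))"

lemma C1I:
  assumes "\<And>x y. ((\<lambda>t. f (t, y)) has_real_derivative fx (x, y)) (at x)"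
    "\<And>x y. ((\<lambda>t. f (x, t)) has_real_derivative fy (x, y)) (at y)"
    "continuous_on UNIV f" "continuous_on UNIV fx" "continuous_on UNIV fy"
  shows "C1 f" "partial_x f = fx" "partial_y f = fy"
proof -
  show x: "partial_x f = fx" and y: "partial_y f = fy"
    using assms(1,2) by (auto simp: partial_x_def partial_y_def fun_eq_iff intro!: DERIV_imp_deriv)
  show "C1 f"
    using assms by (simp add: C1_def x y)
qed

lemma C1_continuous:
  assumes "C1 f"
  shows "continuous_on A f" "continuous_on A (partial_x f)" "continuous_on A (partial_y f)"
  using assms continuous_on_subset[OF _ subset_UNIV] by (auto simp: C1_def)

lemma C1_const: "C1 (\<lambda>_. c)"
  by (rule C1I[where fx = "\<lambda>_. 0" and fy = "\<lambda>_. 0"]) (auto intro!: continuous_intros derivative_eq_intros)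

lemma
  assumes "C1 f" "C1 g"
  shows C1_add: "C1 (\<lambda>p. f p + g p)"
    and C1_mult: "C1 (\<lambda>p. f p * g p)"
    and partial_x_mult: "partial_x (\<lambda>p. f p * g p) = (\<lambda>p. partial_x f p * g p + f p * partial_x g p)"
    and partial_y_mult: "partial_y (\<lambda>p. f p * g p) = (\<lambda>p. partial_y f p * g p + f p * partial_y g p)"
proof -
  have deriv:
    "\<And>x y. ((\<lambda>t. f (t, y)) has_real_derivative partial_x f (x, y)) (at x)"
    "\<And>x y. ((\<lambda>t. f (x, t)) has_real_derivative partial_y f (x, y)) (at y)"
    "\<And>x y. ((\<lambda>t. g (t, y)) has_real_derivative partial_x g (x, y)) (at x)"
    "\<And>x y. ((\<lambda>t. g (x, t)) has_real_derivative partial_y g (x, y)) (at y)"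
    using assms by (auto simp: C1_def)
  show "C1 (\<lambda>p. f p + g p)"
    by (rule C1I[where fx = "\<lambda>p. partial_x f p + partial_x g p"
          and fy = "\<lambda>p. partial_y f p + partial_y g p"])
       (auto intro!: continuous_intros DERIV_add deriv C1_continuous[OF assms(1)] C1_continuous[OF assms(2)])
  show "C1 (\<lambda>p. f p * g p)"
    "partial_x (\<lambda>p. f p * g p) = (\<lambda>p. partial_x f p * g p + f p * partial_x g p)"
    "partial_y (\<lambda>p. f p * g p) = (\<lambda>p. partial_y f p * g p + f p * partial_y g p)"
    by (rule C1I[where fx = "\<lambda>p. partial_x f p * g p + f p * partial_x g p"
          and fy = "\<lambda>p. partial_y f p * g p + f p * partial_y g p"];
        auto intro!: continuous_intros derivative_eq_intros deriv
          C1_continuous[OF assms(1)] C1_continuous[OF assms(2)])+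
qed

lemma C1_sum: "(\<And>a. a \<in> A \<Longrightarrow> C1 (f a)) \<Longrightarrow> C1 (\<lambda>p. \<Sum>a\<in>A. f a p)"
  by (induction A rule: infinite_finite_induct) (auto intro: C1_const C1_add)

lemma C1_basis: "C1 (basis M i j \<alpha>)"
proof -
  define s where "s x = 2 * (x - (xe M i + xe M (i + 1)) / 2) / hx M" for x
  define t where "t y = 2 * (y - (ye M j + ye M (j + 1)) / 2) / hy M" for y
  have s: "(s has_real_derivative 2 / hx M) (at x)" for x
    unfolding s_def divide_inverse by (auto intro!: derivative_eq_intros)
  have t: "(t has_real_derivative 2 / hy M) (at y)" for y
    unfolding t_def divide_inverse by (auto intro!: derivative_eq_intros)
  have cont: "continuous_on UNIV (\<lambda>p. s (fst p))" "continuous_on UNIV (\<lambda>p. t (snd p))"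
    unfolding s_def t_def divide_inverse by (intro continuous_intros)+
  have basis: "basis M i j \<alpha> = (\<lambda>p. poly (legendre (fst \<alpha>)) (s (fst p)) * poly (legendre (snd \<alpha>)) (t (snd p)))"
    by (auto simp: basis_def s_def t_def)
  have P: "((\<lambda>x. poly P (g x)) has_real_derivative poly (pderiv P) (g x) * g') (at x)"
    if "(g has_real_derivative g') (at x)" for P g g' and x :: real
    using DERIV_chain2[OF poly_DERIV that] .
  \<comment> \<open>Opaque names for the slopes keep the rules for quotients from applying to
    them.\<close>
  define a b where "a = 2 / hx M" and "b = 2 / hy M"
  show ?thesis
    unfolding basis
    by (rule C1I[where
          fx = "\<lambda>p. poly (pderiv (legendre (fst \<alpha>))) (s (fst p)) * a * poly (legendre (snd \<alpha>)) (t (snd p))"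
          and fy = "\<lambda>p. poly (legendre (fst \<alpha>)) (s (fst p)) * (poly (pderiv (legendre (snd \<alpha>))) (t (snd p)) * b)"];
        (unfold fst_conv snd_conv)?;
        intro continuous_intros cont DERIV_cmult DERIV_cmult_right P s[folded a_def] t[folded b_def])
qed

lemma continuous_on_dg_val: "continuous_on A (dg_val M K U i j)"
  unfolding dg_val_def[abs_def] by (intro continuous_intros C1_continuous C1_basis)

lemma C1_dg_val: "C1 (\<lambda>p. dg_val M K U i j p $ q)"
  by (auto simp: dg_val_def intro!: C1_sum C1_mult C1_basis C1_const)

section \<open>Integrals over cells and their edges\<close>

lemma cell_eq_cbox: "cell M i j = cbox (xe M i, ye M j) (xe M (i + 1), ye M (j + 1))"
  by (simp add: cell_def cbox_Pair_eq)

lemma integrable_on_cell: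
  fixes f :: "real \<times> real \<Rightarrow> 'a::banach"
  shows "continuous_on (cell M i j) f \<Longrightarrow> f integrable_on cell M i j"
  unfolding cell_eq_cbox by (rule integrable_continuous)

text \<open>An edge carries the index of the cell to its right or above it, so the right and upper
  edges of a cell have a shifted index.\<close>

definition vedge :: "mesh \<Rightarrow> int \<Rightarrow> int \<Rightarrow> (real \<times> real) set" where
  "vedge M i j = {xe M i} \<times> {ye M j..ye M (j + 1)}"

definition hedge :: "mesh \<Rightarrow> int \<Rightarrow> int \<Rightarrow> (real \<times> real) set" where
  "hedge M i j = {xe M i..xe M (i + 1)} \<times> {ye M j}"

lemma edges_subset_cell:
  assumes "valid_mesh M"
  shows "vedge M i j \<subseteq> cell M i j" "vedge M (i + 1) j \<subseteq> cell M i j" "vedge M i j \<subseteq> cell M (i - 1) j"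
    "hedge M i j \<subseteq> cell M i j" "hedge M i (j + 1) \<subseteq> cell M i j" "hedge M i j \<subseteq> cell M i (j - 1)"
  using assms by (auto simp: vedge_def hedge_def cell_def valid_mesh_def xe_def ye_def algebra_simps)

text \<open>Each field is tested only on its own edge, as a numerical flux is controlled only where
  the traces of both adjacent cells are well defined.\<close>

definition edge_continuous :: "mesh \<Rightarrow> int \<Rightarrow> int \<Rightarrow>
  (real \<times> real \<Rightarrow> 'a::topological_space) \<Rightarrow> (real \<times> real \<Rightarrow> 'a) \<Rightarrow>
  (real \<times> real \<Rightarrow> 'a) \<Rightarrow> (real \<times> real \<Rightarrow> 'a) \<Rightarrow> bool" where
  "edge_continuous M i j R L T B \<longleftrightarrow>
     continuous_on (vedge M (i + 1) j) R \<and> continuous_on (vedge M i j) L \<and>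
     continuous_on (hedge M i (j + 1)) T \<and> continuous_on (hedge M i j) B"

lemma edge_continuous_integrable:
  fixes R L T B :: "real \<times> real \<Rightarrow> 'a::euclidean_space"
  assumes "edge_continuous M i j R L T B"
  shows "(\<lambda>y. R (xe M (i + 1), y)) integrable_on {ye M j..ye M (j + 1)}"
    "(\<lambda>y. L (xe M i, y)) integrable_on {ye M j..ye M (j + 1)}"
    "(\<lambda>x. T (x, ye M (j + 1))) integrable_on {xe M i..xe M (i + 1)}"
    "(\<lambda>x. B (x, ye M j)) integrable_on {xe M i..xe M (i + 1)}"
  using assms unfolding edge_continuous_def
  by (auto intro!: integrable_continuous_real continuous_intros
      elim!: continuous_on_compose2 simp: vedge_def hedge_def)

lemma boundary_integral_cong:
  assumes "\<And>p. p \<in> vedge M (i + 1) j \<Longrightarrow> R p = R' p" "\<And>p. p \<in> vedge M i j \<Longrightarrow> L p = L' p"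
    "\<And>p. p \<in> hedge M i (j + 1) \<Longrightarrow> T p = T' p" "\<And>p. p \<in> hedge M i j \<Longrightarrow> B p = B' p"
  shows "boundary_integral M i j R L T B = boundary_integral M i j R' L' T' B'"
  using assms unfolding boundary_integral_def
  by (intro arg_cong2[where f = "(+)"] arg_cong2[where f = "(-)"] integral_cong)
     (auto simp: vedge_def hedge_def)

lemma boundary_integral_linear:
  fixes R L T B :: "real \<times> real \<Rightarrow> 'a::euclidean_space" and m :: "'a \<Rightarrow> 'b::euclidean_space"
  assumes "edge_continuous M i j R L T B" "bounded_linear m"
  shows "boundary_integral M i j (\<lambda>p. m (R p)) (\<lambda>p. m (L p)) (\<lambda>p. m (T p)) (\<lambda>p. m (B p)) =
     m (boundary_integral M i j R L T B)"
proof -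
  interpret m: bounded_linear m by fact
  show ?thesis
    unfolding boundary_integral_def m.add m.diff
    using edge_continuous_integrable[OF assms(1)] assms(2)
    by (simp add: integral_linear[symmetric] o_def)
qed

lemma boundary_integral_add:
  fixes R L T B R' L' T' B' :: "real \<times> real \<Rightarrow> 'a::euclidean_space"
  assumes "edge_continuous M i j R L T B" "edge_continuous M i j R' L' T' B'"
  shows "boundary_integral M i j (\<lambda>p. R p + R' p) (\<lambda>p. L p + L' p) (\<lambda>p. T p + T' p) (\<lambda>p. B p + B' p) =
     boundary_integral M i j R L T B + boundary_integral M i j R' L' T' B'"
  unfolding boundary_integral_def
  using edge_continuous_integrable[OF assms(1)] edge_continuous_integrable[OF assms(2)]
  by (simp add: integral_add)

text \<open>Iterated integration reduces the divergence theorem for the field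
  \<open>(a * f, b * f)\<close> to the fundamental theorem of calculus in each variable.\<close>

lemma green:
  assumes "valid_mesh M" "C1 f"
  shows "integral (cell M i j) (\<lambda>p. a * partial_x f p + b * partial_y f p) =
     boundary_integral M i j (\<lambda>p. a * f p) (\<lambda>p. a * f p) (\<lambda>p. b * f p) (\<lambda>p. b * f p)"
proof -
  have le: "xe M i \<le> xe M (i + 1)" "ye M j \<le> ye M (j + 1)"
    using assms(1) by (auto simp: valid_mesh_def xe_def ye_def algebra_simps)
  have int: "(\<lambda>y. f (x, y)) integrable_on {c..d}" "(\<lambda>x. f (x, y)) integrable_on {c..d}" for x y c d
    by (auto intro!: integrable_continuous_real continuous_on_compose2[OF C1_continuous(1)[OF assms(2), of UNIV]]
        continuous_intros)
  have dx: "integral {xe M i..xe M (i + 1)} (\<lambda>x. partial_x f (x, y)) = f (xe M (i + 1), y) - f (xe M i, y)" for y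
    using assms(2) le
    by (intro integral_unique fundamental_theorem_of_calculus)
       (auto simp: C1_def has_real_derivative_iff_has_vector_derivative[symmetric]
          intro: has_field_derivative_at_within)
  have dy: "integral {ye M j..ye M (j + 1)} (\<lambda>y. partial_y f (x, y)) = f (x, ye M (j + 1)) - f (x, ye M j)" for x
    using assms(2) le
    by (intro integral_unique fundamental_theorem_of_calculus)
       (auto simp: C1_def has_real_derivative_iff_has_vector_derivative[symmetric]
          intro: has_field_derivative_at_within)
  \<comment> \<open>The integral over the product has \<open>x\<close> as its outer variable;
    swapping the order brings the \<open>x\<close>-integral inside, where \<open>dx\<close>
    applies.\<close>
  have "integral (cell M i j) (partial_x f) =
      integral {ye M j..ye M (j + 1)} (\<lambda>y. integral {xe M i..xe M (i + 1)} (\<lambda>x. partial_x f (x, y)))"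
    using integral_swap_continuous[of "xe M i" "ye M j" "xe M (i + 1)" "ye M (j + 1)" "\<lambda>x y. partial_x f (x, y)"]
      integral_prod_continuous[of "xe M i" "ye M j" "xe M (i + 1)" "ye M (j + 1)" "partial_x f"]
      C1_continuous(2)[OF assms(2)]
    by (simp add: cell_eq_cbox)
  then have X: "integral (cell M i j) (partial_x f) =
      integral {ye M j..ye M (j + 1)} (\<lambda>y. f (xe M (i + 1), y)) - integral {ye M j..ye M (j + 1)} (\<lambda>y. f (xe M i, y))"
    by (simp add: dx integral_diff int)
  have "integral (cell M i j) (partial_y f) =
      integral {xe M i..xe M (i + 1)} (\<lambda>x. integral {ye M j..ye M (j + 1)} (\<lambda>y. partial_y f (x, y)))"
    using integral_prod_continuous[of "xe M i" "ye M j" "xe M (i + 1)" "ye M (j + 1)" "partial_y f"]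
      C1_continuous(3)[OF assms(2)]
    by (simp add: cell_eq_cbox)
  then have Y: "integral (cell M i j) (partial_y f) =
      integral {xe M i..xe M (i + 1)} (\<lambda>x. f (x, ye M (j + 1))) - integral {xe M i..xe M (i + 1)} (\<lambda>x. f (x, ye M j))"
    by (simp add: dy integral_diff int)
  have "integral (cell M i j) (\<lambda>p. a * partial_x f p + b * partial_y f p) =
      a * integral (cell M i j) (partial_x f) + b * integral (cell M i j) (partial_y f)"
    by (subst integral_add) (auto intro!: integrable_on_cell continuous_intros C1_continuous[OF assms(2)])
  then show ?thesis
    by (simp add: X Y boundary_integral_def algebra_simps)
qed

section \<open>The semi-discrete operator at uniform states\<close>

text \<open>Up to constants, applying \<open>m\<close> turns all fluxes into \<kappa> times those of
  \<open>z\<close>. Green's formula for \<phi> cancels the constants. Green's formula for the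
  product of \<phi> and \<open>z\<close> converts the conservative volume term into the
  nonconservative one plus the boundary term with interior traces.\<close>

lemma transported_weak_form:
  fixes C R L T B :: "real \<times> real \<Rightarrow> state"
  assumes M: "valid_mesh M" and trans: "transported Q u0 p0 m \<kappa> c"
    and C: "continuous_on UNIV C" "\<And>p. p \<in> cell M i j \<Longrightarrow> uniform_state Q u0 p0 (C p)"
    and R: "continuous_on UNIV R" "\<And>p. p \<in> cell M (i + 1) j \<Longrightarrow> uniform_state Q u0 p0 (R p)"
    and L: "continuous_on UNIV L" "\<And>p. p \<in> cell M (i - 1) j \<Longrightarrow> uniform_state Q u0 p0 (L p)"
    and T: "continuous_on UNIV T" "\<And>p. p \<in> cell M i (j + 1) \<Longrightarrow> uniform_state Q u0 p0 (T p)"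
    and B: "continuous_on UNIV B" "\<And>p. p \<in> cell M i (j - 1) \<Longrightarrow> uniform_state Q u0 p0 (B p)"
    and \<phi>: "C1 \<phi>" and z: "C1 (\<lambda>p. C p $ 6)"
  defines "z \<equiv> \<lambda>p. C p $ 6" and "u \<equiv> \<lambda>p. fst (velocity (C p))" and "v \<equiv> \<lambda>p. snd (velocity (C p))"
  shows "m (integral (cell M i j) (\<lambda>p. partial_x \<phi> p *\<^sub>R flux1 Q (C p) + partial_y \<phi> p *\<^sub>R flux2 Q (C p))
          - boundary_integral M i j
              (\<lambda>p. \<phi> p *\<^sub>R num_flux1 Q (C p) (R p)) (\<lambda>p. \<phi> p *\<^sub>R num_flux1 Q (L p) (C p))
              (\<lambda>p. \<phi> p *\<^sub>R num_flux2 Q (C p) (T p)) (\<lambda>p. \<phi> p *\<^sub>R num_flux2 Q (B p) (C p))) =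
        \<kappa> * (- integral (cell M i j) (\<lambda>p. \<phi> p * (u p * partial_x z p + v p * partial_y z p))
          - boundary_integral M i j
              (\<lambda>p. \<phi> p * num_uz Q (C p) (C p) (R p)) (\<lambda>p. \<phi> p * num_uz Q (C p) (L p) (C p))
              (\<lambda>p. \<phi> p * num_vz Q (C p) (C p) (T p)) (\<lambda>p. \<phi> p * num_vz Q (C p) (B p) (C p))
          + boundary_integral M i j
              (\<lambda>p. \<phi> p * (u p * z p)) (\<lambda>p. \<phi> p * (u p * z p))
              (\<lambda>p. \<phi> p * (v p * z p)) (\<lambda>p. \<phi> p * (v p * z p)))"
    (is "m (integral _ ?F - boundary_integral M i j ?FR ?FL ?FT ?FB) =
      \<kappa> * (- ?A - boundary_integral M i j ?NR ?NL ?NT ?NB + ?Z)")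
proof -
  interpret m: bounded_linear m
    using trans by (simp add: transported_def)
  obtain d1 d2 where flux:
      "\<And>U. uniform_state Q u0 p0 U \<Longrightarrow> m (flux1 Q U) = fst u0 * \<kappa> * U $ 6 + d1"
      "\<And>U. uniform_state Q u0 p0 U \<Longrightarrow> m (flux2 Q U) = snd u0 * \<kappa> * U $ 6 + d2"
    and num:
      "\<And>Ui Um Up. velocity Ui = u0 \<Longrightarrow> uniform_state Q u0 p0 Um \<Longrightarrow> uniform_state Q u0 p0 Up \<Longrightarrow>
         m (num_flux1 Q Um Up) = \<kappa> * num_uz Q Ui Um Up + d1"
      "\<And>Ui Um Up. velocity Ui = u0 \<Longrightarrow> uniform_state Q u0 p0 Um \<Longrightarrow> uniform_state Q u0 p0 Up \<Longrightarrow>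
         m (num_flux2 Q Um Up) = \<kappa> * num_vz Q Ui Um Up + d2"
    by (rule transported_num_flux[OF trans], rule that)
  have C1z: "C1 z" using z by (simp add: z_def)
  note C1s = C1_continuous[OF \<phi>] C1_continuous[OF C1z]
  have sub: "continuous_on A C" "continuous_on A R" "continuous_on A L" "continuous_on A T" "continuous_on A B" for A
    by (rule continuous_on_subset[OF C(1)] continuous_on_subset[OF R(1)] continuous_on_subset[OF L(1)]
        continuous_on_subset[OF T(1)] continuous_on_subset[OF B(1)]; simp)+
  have uni: "uniform_state Q u0 p0 U \<Longrightarrow> well_defined Q U" "uniform_state Q u0 p0 U \<Longrightarrow> velocity U = u0" for U
    by (auto simp: uniform_state_def)
  note e = edges_subset_cell[OF M, THEN subsetD]
  have e': "p \<in> vedge M (i + 1) j \<Longrightarrow> uniform_state Q u0 p0 (R p)"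
      "p \<in> vedge M i j \<Longrightarrow> uniform_state Q u0 p0 (L p)"
      "p \<in> hedge M i (j + 1) \<Longrightarrow> uniform_state Q u0 p0 (T p)"
      "p \<in> hedge M i j \<Longrightarrow> uniform_state Q u0 p0 (B p)"
      "p \<in> vedge M (i + 1) j \<Longrightarrow> uniform_state Q u0 p0 (C p)"
      "p \<in> vedge M i j \<Longrightarrow> uniform_state Q u0 p0 (C p)"
      "p \<in> hedge M i (j + 1) \<Longrightarrow> uniform_state Q u0 p0 (C p)"
      "p \<in> hedge M i j \<Longrightarrow> uniform_state Q u0 p0 (C p)" for p
    by ((rule C(2) R(2) L(2) T(2) B(2), erule e)+)
  have edgeF: "edge_continuous M i j ?FR ?FL ?FT ?FB"
    unfolding edge_continuous_def
    by (intro conjI continuous_on_scaleR C1s continuous_on_num_flux1 continuous_on_num_flux2 sub uni e')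
  have edgeN: "edge_continuous M i j ?NR ?NL ?NT ?NB"
    unfolding edge_continuous_def
    by (intro conjI continuous_on_mult C1s continuous_on_num_uz continuous_on_num_vz
        continuous_on_velocity[where Q = Q] sub uni e')
  have edge_\<phi>: "edge_continuous M i j (\<lambda>p. d1 * \<phi> p) (\<lambda>p. d1 * \<phi> p) (\<lambda>p. d2 * \<phi> p) (\<lambda>p. d2 * \<phi> p)"
    unfolding edge_continuous_def by (intro conjI continuous_intros C1s)
  have edge_\<kappa>N: "edge_continuous M i j (\<lambda>p. \<kappa> * ?NR p) (\<lambda>p. \<kappa> * ?NL p) (\<lambda>p. \<kappa> * ?NT p) (\<lambda>p. \<kappa> * ?NB p)"
    using edgeN unfolding edge_continuous_def by (auto intro: continuous_on_mult_left)
  define a b where "a = fst u0" and "b = snd u0"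
  define I :: "(real \<times> real \<Rightarrow> real) \<Rightarrow> real" where "I = integral (cell M i j)"
  have Fcont: "continuous_on (cell M i j) ?F"
    by (intro continuous_intros C1s continuous_on_flux1 continuous_on_flux2 sub uni C(2))
  have "m (integral (cell M i j) ?F) = I (\<lambda>p. m (?F p))"
    using integral_linear[OF integrable_on_cell[OF Fcont] m.bounded_linear_axioms]
    by (simp add: o_def I_def)
  also have "\<dots> = I (\<lambda>p. \<kappa> * (a * (partial_x \<phi> p * z p) + b * (partial_y \<phi> p * z p))
      + (d1 * partial_x \<phi> p + d2 * partial_y \<phi> p))"
    unfolding I_def using C(2)
    by (intro integral_cong) (simp add: m.add m.scaleR flux z_def a_def b_def algebra_simps)
  also have "\<dots> = \<kappa> * I (\<lambda>p. a * (partial_x \<phi> p * z p) + b * (partial_y \<phi> p * z p))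
      + I (\<lambda>p. d1 * partial_x \<phi> p + d2 * partial_y \<phi> p)"
    unfolding I_def
    by (subst integral_add) (auto intro!: integrable_on_cell continuous_intros C1s)
  finally have mF: "m (integral (cell M i j) ?F) = \<dots>" .
  \<comment> \<open>The constants \<open>d1\<close> and \<open>d2\<close> in the volume term yield
    exactly the boundary integral that they produce in the numerical fluxes.\<close>
  have green\<phi>: "I (\<lambda>p. d1 * partial_x \<phi> p + d2 * partial_y \<phi> p) =
      boundary_integral M i j (\<lambda>p. d1 * \<phi> p) (\<lambda>p. d1 * \<phi> p) (\<lambda>p. d2 * \<phi> p) (\<lambda>p. d2 * \<phi> p)"
    unfolding I_def by (rule green[OF M \<phi>])
  have A: "?A = I (\<lambda>p. a * (\<phi> p * partial_x z p) + b * (\<phi> p * partial_y z p))"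
    unfolding I_def using C(2)
    by (intro integral_cong) (simp add: u_def v_def uni a_def b_def algebra_simps)
  \<comment> \<open>Product rule: the two volume terms add up to the divergence of \<phi> times
    \<open>z\<close> times the constant velocity.\<close>
  have "I (\<lambda>p. a * (partial_x \<phi> p * z p) + b * (partial_y \<phi> p * z p)) + ?A =
      I (\<lambda>p. a * partial_x (\<lambda>p. \<phi> p * z p) p + b * partial_y (\<lambda>p. \<phi> p * z p) p)"
    unfolding A unfolding I_def partial_x_mult[OF \<phi> C1z] partial_y_mult[OF \<phi> C1z]
    by (subst integral_add[symmetric])
       (auto intro!: integrable_on_cell continuous_intros C1s integral_cong simp: algebra_simps)
  also have "\<dots> = boundary_integral M i j (\<lambda>p. a * (\<phi> p * z p)) (\<lambda>p. a * (\<phi> p * z p))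
      (\<lambda>p. b * (\<phi> p * z p)) (\<lambda>p. b * (\<phi> p * z p))"
    unfolding I_def by (rule green[OF M C1_mult[OF \<phi> C1z]])
  also have "\<dots> = ?Z"
    by (intro boundary_integral_cong) (simp_all add: u_def v_def uni e' a_def b_def)
  finally have Z: "I (\<lambda>p. a * (partial_x \<phi> p * z p) + b * (partial_y \<phi> p * z p)) + ?A = ?Z" .
  \<comment> \<open>On each edge \<open>Ui\<close> is the interior trace \<open>C p\<close>, whether
    it is the left/lower or the right/upper one.\<close>
  have num_edge:
      "p \<in> vedge M (i + 1) j \<Longrightarrow> m (num_flux1 Q (C p) (R p)) = \<kappa> * num_uz Q (C p) (C p) (R p) + d1"
      "p \<in> vedge M i j \<Longrightarrow> m (num_flux1 Q (L p) (C p)) = \<kappa> * num_uz Q (C p) (L p) (C p) + d1"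
      "p \<in> hedge M i (j + 1) \<Longrightarrow> m (num_flux2 Q (C p) (T p)) = \<kappa> * num_vz Q (C p) (C p) (T p) + d2"
      "p \<in> hedge M i j \<Longrightarrow> m (num_flux2 Q (B p) (C p)) = \<kappa> * num_vz Q (C p) (B p) (C p) + d2" for p
    by (intro num uni(2) e'; assumption)+
  have "m (boundary_integral M i j ?FR ?FL ?FT ?FB) =
      boundary_integral M i j (\<lambda>p. m (?FR p)) (\<lambda>p. m (?FL p)) (\<lambda>p. m (?FT p)) (\<lambda>p. m (?FB p))"
    by (rule boundary_integral_linear[OF edgeF m.bounded_linear_axioms, symmetric])
  also have "\<dots> = boundary_integral M i j (\<lambda>p. \<kappa> * ?NR p + d1 * \<phi> p) (\<lambda>p. \<kappa> * ?NL p + d1 * \<phi> p)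
      (\<lambda>p. \<kappa> * ?NT p + d2 * \<phi> p) (\<lambda>p. \<kappa> * ?NB p + d2 * \<phi> p)"
    by (intro boundary_integral_cong) (simp_all add: m.scaleR num_edge distrib_left mult_ac)
  also have "\<dots> = \<kappa> * boundary_integral M i j ?NR ?NL ?NT ?NB +
      boundary_integral M i j (\<lambda>p. d1 * \<phi> p) (\<lambda>p. d1 * \<phi> p) (\<lambda>p. d2 * \<phi> p) (\<lambda>p. d2 * \<phi> p)"
    by (simp only: boundary_integral_add[OF edge_\<kappa>N edge_\<phi>]
        boundary_integral_linear[OF edgeN bounded_linear_mult_right])
  finally have mB: "m (boundary_integral M i j ?FR ?FL ?FT ?FB) = \<dots>" .
  show ?thesis
    unfolding m.diff mB mF[unfolded I_def] green\<phi>[unfolded I_def] Z[symmetric]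
    by (simp add: I_def algebra_simps)
qed

section \<open>From the weak form to the modal coefficients of the residual\<close>

definition uniform_on :: "eos \<Rightarrow> mesh \<Rightarrow> nat \<Rightarrow> (int \<times> int) set \<Rightarrow> dof \<Rightarrow> real \<times> real \<Rightarrow> real \<Rightarrow> bool" where
  "uniform_on Q M K A U u0 p0 \<longleftrightarrow>
     (\<forall>(i, j)\<in>A. \<forall>p\<in>cell M i j. uniform_state Q u0 p0 (dg_val M K U i j p))"

lemma uniform_on_iff:
  "uniform_on Q M K A U u0 p0 \<longleftrightarrow>
     well_defined_on Q M K A U \<and> velocity_is M K A U u0 \<and> pressure_is Q M K A U p0"
  unfolding uniform_on_def uniform_state_def well_defined_on_def velocity_is_def pressure_is_def
  by blast

lemma linear_dg_val:
  fixes l :: "state \<Rightarrow> real"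
  assumes "linear l"
  shows "l (dg_val M K U i j p) = (\<Sum>\<alpha>\<in>modes K. basis M i j \<alpha> p * l (U i j \<alpha>))"
  by (simp add: dg_val_def linear_sum[OF assms] linear_cmul[OF assms])

text \<open>At uniform states this functional has the constant value \<open>c\<close>; linearity
  allows it to be evaluated mode by mode.\<close>

lemma linear_residual:
  assumes "transported Q u0 p0 m \<kappa> c"
  shows "linear (\<lambda>U. m (conserved U) - \<kappa> * U $ 6)"
proof -
  have "linear m" using assms by (simp add: transported_def bounded_linear.linear)
  then show ?thesis
    by (intro linearI) (simp_all add: linear_add linear_cmul linear_conserved algebra_simps)
qed

text \<open>The expansion is itself a combination of the test functions, so its square has integral
  zero. By continuity it vanishes on the cell, and the basis is independent.\<close>

lemma galerkin_orthogonal_zero: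
  assumes M: "valid_mesh M"
    and orth: "\<And>\<beta>. \<beta> \<in> modes K \<Longrightarrow>
      integral (cell M i j) (\<lambda>p. basis M i j \<beta> p * (\<Sum>\<alpha>\<in>modes K. basis M i j \<alpha> p * c \<alpha>)) = 0"
    and "\<alpha> \<in> modes K"
  shows "c \<alpha> = 0"
proof -
  let ?w = "\<lambda>p. \<Sum>\<alpha>\<in>modes K. basis M i j \<alpha> p * c \<alpha>"
  note [continuous_intros] = C1_continuous[OF C1_basis]
  have "integral (cell M i j) (\<lambda>p. ?w p * ?w p) =
      integral (cell M i j) (\<lambda>p. \<Sum>\<beta>\<in>modes K. c \<beta> * (basis M i j \<beta> p * ?w p))"
    by (intro integral_cong) (simp add: sum_distrib_right sum_distrib_left mult_ac)
  also have "\<dots> = (\<Sum>\<beta>\<in>modes K. c \<beta> * integral (cell M i j) (\<lambda>p. basis M i j \<beta> p * ?w p))"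
    by (subst integral_sum) (auto intro!: integrable_on_cell continuous_intros)
  also have "\<dots> = 0"
    using orth by simp
  finally have "integral (cell M i j) (\<lambda>p. ?w p * ?w p) = 0" .
  moreover have "box (xe M i, ye M j) (xe M (i + 1), ye M (j + 1)) \<noteq> {}"
    using M by (auto simp: box_ne_empty Basis_prod_def valid_mesh_def xe_def ye_def algebra_simps)
  moreover have "continuous_on (cell M i j) (\<lambda>p. ?w p * ?w p)"
    by (intro continuous_intros)
  ultimately have "\<forall>p\<in>cell M i j. ?w p * ?w p = 0"
    unfolding cell_eq_cbox by (subst (asm) integral_cbox_eq_0_iff) auto
  then show ?thesis
    using basis_independent[OF M _ assms(3), of i j c] by simp
qed

text \<open>The weak form makes the residual of \<open>V\<close> orthogonal to every basis function,
  and the residual lies in their span.\<close>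

lemma dg_operator_residual_zero:
  assumes M: "valid_mesh M" and bc: "extends_mesh_data M bc" "bc_compatible Q M K bc u0 p0"
    and U: "uniform_on Q M K (cells M) U u0 p0" and V: "dg_operator Q M K bc U V"
    and trans: "transported Q u0 p0 m \<kappa> c" and ij: "(i, j) \<in> cells M" and \<alpha>: "\<alpha> \<in> modes K"
  shows "m (conserved (V i j \<alpha>)) - \<kappa> * V i j \<alpha> $ 6 = 0"
proof (rule galerkin_orthogonal_zero[OF M _ \<alpha>, where i = i and j = j])
  interpret m: bounded_linear m
    using trans by (simp add: transported_def)
  fix \<beta> assume \<beta>: "\<beta> \<in> modes K"
  have "dg_val M K (bc U) k l = dg_val M K U k l" if "(k, l) \<in> cells M" for k l
  proof -
    have "bc U k l = U k l"
      using bc(1) that by (auto simp: extends_mesh_data_def)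
    then show ?thesis
      unfolding dg_val_def[abs_def] by (simp only:)
  qed
  then have "uniform_on Q M K (cells M) (bc U) u0 p0"
    using U by (auto simp: uniform_on_def)
  moreover have "uniform_on Q M K (ghost_cells M) (bc U) u0 p0"
    using U bc(2) by (simp add: bc_compatible_def uniform_on_iff)
  ultimately have all: "uniform_state Q u0 p0 (dg_val M K (bc U) k l p)"
    if "(k, l) \<in> cells M \<union> ghost_cells M" "p \<in> cell M k l" for k l p
    using that by (auto simp: uniform_on_def)
  \<comment> \<open>Every neighbour across an edge is a mesh cell or a ghost cell, so all traces in
    the fluxes are uniform.\<close>
  have near: "(i, j) \<in> cells M \<union> ghost_cells M"
    "(i + 1, j) \<in> cells M \<union> ghost_cells M" "(i - 1, j) \<in> cells M \<union> ghost_cells M"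
    "(i, j + 1) \<in> cells M \<union> ghost_cells M" "(i, j - 1) \<in> cells M \<union> ghost_cells M"
    using ij by (auto simp: cells_def ghost_cells_def)
  let ?\<phi> = "basis M i j \<beta>" and ?V = "dg_val M K V i j"
  note V' = V[unfolded dg_operator_def, rule_format, OF ij, unfolded prod.case, rule_format, OF \<beta>,
      unfolded Let_def]
  have cont: "continuous_on (cell M i j) (\<lambda>p. ?\<phi> p *\<^sub>R conserved (?V p))"
    by (intro continuous_intros C1_continuous C1_basis continuous_on_conserved continuous_on_dg_val)
  have cont': "continuous_on (cell M i j) (\<lambda>p. \<kappa> * (?V p $ 6 * ?\<phi> p))"
    by (intro continuous_intros C1_continuous C1_basis continuous_on_dg_val)
  have "m (integral (cell M i j) (\<lambda>p. ?\<phi> p *\<^sub>R conserved (?V p))) =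
      \<kappa> * integral (cell M i j) (\<lambda>p. ?V p $ 6 * ?\<phi> p)"
    unfolding V'[THEN conjunct1] V'[THEN conjunct2]
    by (rule transported_weak_form[OF M trans])
       (intro continuous_on_dg_val C1_basis C1_dg_val all near; assumption)+
  moreover have "integral (cell M i j) (\<lambda>p. m (?\<phi> p *\<^sub>R conserved (?V p))) =
      m (integral (cell M i j) (\<lambda>p. ?\<phi> p *\<^sub>R conserved (?V p)))"
    using integral_linear[OF integrable_on_cell[OF cont] m.bounded_linear_axioms] by (simp add: o_def)
  moreover have "continuous_on (cell M i j) (\<lambda>p. m (?\<phi> p *\<^sub>R conserved (?V p)))"
    by (rule m.continuous_on[OF cont])
  ultimately have "integral (cell M i j) (\<lambda>p. m (?\<phi> p *\<^sub>R conserved (?V p)) - \<kappa> * (?V p $ 6 * ?\<phi> p)) = 0"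
    by (subst integral_diff) (auto intro: integrable_on_cell cont')
  moreover have "(\<Sum>\<alpha>\<in>modes K. basis M i j \<alpha> p * (m (conserved (V i j \<alpha>)) - \<kappa> * V i j \<alpha> $ 6)) =
      m (conserved (?V p)) - \<kappa> * ?V p $ 6" for p
    by (rule linear_dg_val[OF linear_residual[OF trans], symmetric])
  ultimately show "integral (cell M i j) (\<lambda>p. ?\<phi> p * (\<Sum>\<alpha>\<in>modes K. basis M i j \<alpha> p *
      (m (conserved (V i j \<alpha>)) - \<kappa> * V i j \<alpha> $ 6))) = 0"
    by (simp add: m.scaleR right_diff_distrib mult_ac)
qed

section \<open>Modal coefficients of uniform solutions\<close>

lemma basis_0: "basis M i j (0, 0) p = 1"
  by (cases p) (simp add: basis_def legendre_0)

lemma zero_in_modes [simp]: "(0, 0) \<in> modes K"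
  by (simp add: modes_def)

text \<open>Coefficient form of \<open>l\<close> being constantly \<open>c\<close> on the mesh: the
  basis function of mode \<open>(0, 0)\<close> is 1.\<close>

definition modal :: "mesh \<Rightarrow> nat \<Rightarrow> (state \<Rightarrow> real) \<Rightarrow> real \<Rightarrow> dof \<Rightarrow> bool" where
  "modal M K l c U \<longleftrightarrow> (\<forall>i j \<alpha>. (i, j) \<in> cells M \<longrightarrow> \<alpha> \<in> modes K \<longrightarrow>
     l (U i j \<alpha>) = (if \<alpha> = (0, 0) then c else 0))"

lemma modal_iff:
  assumes "valid_mesh M" "linear l"
  shows "modal M K l c U \<longleftrightarrow> (\<forall>(i, j)\<in>cells M. \<forall>p\<in>cell M i j. l (dg_val M K U i j p) = c)"
proof -
  \<comment> \<open>The constant \<open>c\<close> is absorbed into the mode \<open>(0, 0)\<close>,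
    leaving a homogeneous sum to which linear independence applies.\<close>
  have sum: "l (dg_val M K U i j p) = (\<Sum>\<alpha>\<in>modes K. basis M i j \<alpha> p * (l (U i j \<alpha>) - (if \<alpha> = (0, 0) then c else 0))) + c"
    for i j p
  proof -
    have "(\<Sum>\<alpha>\<in>modes K. basis M i j \<alpha> p * (if \<alpha> = (0, 0) then c else 0)) = c"
      by (subst sum.remove[of _ "(0, 0)"]) (simp_all add: basis_0)
    then show ?thesis
      by (simp add: linear_dg_val[OF assms(2)] right_diff_distrib sum_subtractf)
  qed
  show ?thesis
  proof
    assume "modal M K l c U"
    then have *: "l (U i j \<alpha>) - (if \<alpha> = (0, 0) then c else 0) = 0"
      if "(i, j) \<in> cells M" "\<alpha> \<in> modes K" for i j \<alpha>
      using that unfolding modal_def by (simp del: split_paired_All)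
    have "l (dg_val M K U i j p) = c" if "(i, j) \<in> cells M" for i j p
      unfolding sum by (subst sum.neutral) (use * that in simp_all)
    then show "\<forall>(i, j)\<in>cells M. \<forall>p\<in>cell M i j. l (dg_val M K U i j p) = c"
      by blast
  next
    assume *: "\<forall>(i, j)\<in>cells M. \<forall>p\<in>cell M i j. l (dg_val M K U i j p) = c"
    have "l (U i j \<alpha>) = (if \<alpha> = (0, 0) then c else 0)" if ij: "(i, j) \<in> cells M" and \<alpha>: "\<alpha> \<in> modes K"
      for i j \<alpha>
    proof -
      have "(\<Sum>\<alpha>\<in>modes K. basis M i j \<alpha> p * (l (U i j \<alpha>) - (if \<alpha> = (0, 0) then c else 0))) = 0"
        if "p \<in> cell M i j" for p
      proof -
        have "l (dg_val M K U i j p) = c"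
          using * ij that by blast
        then show ?thesis
          unfolding sum by (simp only: add_cancel_left_left)
      qed
      then have "l (U i j \<alpha>) - (if \<alpha> = (0, 0) then c else 0) = 0"
        by (rule basis_independent[OF assms(1) _ \<alpha>, of i j "\<lambda>\<alpha>. l (U i j \<alpha>) - (if \<alpha> = (0, 0) then c else 0)"])
      then show ?thesis
        by (rule iffD2[OF eq_iff_diff_eq_0])
    qed
    then show "modal M K l c U"
      unfolding modal_def by blast
  qed
qed

text \<open>Quantifying over all transported functionals treats momentum and energy at once.
  Conversely, their three instances characterize uniformity among well-defined states.\<close>

lemma uniform_on_modal_iff:
  assumes "valid_mesh M"
  shows "uniform_on Q M K (cells M) U u0 p0 \<longleftrightarrow> well_defined_on Q M K (cells M) U \<and>
    (\<forall>m \<kappa> c. transported Q u0 p0 m \<kappa> c \<longrightarrow> modal M K (\<lambda>U. m (conserved U) - \<kappa> * U $ 6) c U)"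
    (is "?L \<longleftrightarrow> ?W \<and> ?R")
proof
  assume ?L
  then have ?W
    by (simp add: uniform_on_iff)
  moreover have ?R
  proof (intro allI impI)
    fix m \<kappa> c assume trans: "transported Q u0 p0 m \<kappa> c"
    then have "m (conserved U) - \<kappa> * U $ 6 = c" if "uniform_state Q u0 p0 U" for U
      using that by (simp add: transported_def)
    with \<open>?L\<close> show "modal M K (\<lambda>U. m (conserved U) - \<kappa> * U $ 6) c U"
      unfolding modal_iff[OF assms linear_residual[OF trans]] uniform_on_def by blast
  qed
  ultimately show "?W \<and> ?R" ..
next
  assume WR: "?W \<and> ?R"
  have "m (conserved (dg_val M K U i j p)) = \<kappa> * dg_val M K U i j p $ 6 + c"
    if trans: "transported Q u0 p0 m \<kappa> c" and "(i, j) \<in> cells M" "p \<in> cell M i j" for m \<kappa> c i j p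
  proof -
    have "m (conserved (dg_val M K U i j p)) - \<kappa> * dg_val M K U i j p $ 6 = c"
      using WR that modal_iff[OF assms linear_residual[OF trans]] by blast
    then show ?thesis by simp
  qed
  note this[OF transported_excess_momentum1] this[OF transported_excess_momentum2]
    this[OF transported_internal_energy]
  moreover have "well_defined Q (dg_val M K U i j p)" if "(i, j) \<in> cells M" "p \<in> cell M i j" for i j p
    using WR that unfolding well_defined_on_def by blast
  ultimately have "uniform_state Q u0 p0 (dg_val M K U i j p)"
    if "(i, j) \<in> cells M" "p \<in> cell M i j" for i j p
    using that by (simp add: uniform_state_iff)
  then show ?L
    unfolding uniform_on_def by blast
qed

section \<open>Invariance under damping and Runge-Kutta stages\<close>

lemma modal_oe_operator:
  assumes "linear l" "modal M K l c U"
  shows "modal M K l c (oe_operator M K bc \<beta>x \<beta>y \<Delta>t U)"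
  unfolding modal_def
proof (intro allI impI)
  fix i j \<alpha> assume "(i, j) \<in> cells M" "\<alpha> \<in> modes K"
  then have "l (U i j \<alpha>) = (if \<alpha> = (0, 0) then c else 0)"
    using assms(2) unfolding modal_def by blast
  then show "l (oe_operator M K bc \<beta>x \<beta>y \<Delta>t U i j \<alpha>) = (if \<alpha> = (0, 0) then c else 0)"
    \<comment> \<open>The exponential factor scales only modes of positive degree, where
      \<open>l\<close> is zero; the mode \<open>(0, 0)\<close> is left unchanged.\<close>
    by (auto simp: oe_operator_def linear_cmul[OF assms(1)] Let_def prod_eq_iff)
qed

text \<open>A stage may use all earlier ones, hence strong induction. The affine equations pass from
  stage to stage; well-definedness does not follow from them and is taken from
  \<open>defined\<close>.\<close>

lemma uniform_on_rk_stages: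
  assumes M: "valid_mesh M" and bc: "extends_mesh_data M bc" "bc_compatible Q M K bc u0 p0"
    and ssp: "ssp S"
    and step: "oedg_step Q M K bc \<beta>x \<beta>y S \<Delta>t U0 Uh Us U1"
    and defined: "\<forall>r\<le>stages S. well_defined_on Q M K (cells M) (Us r)"
    and init: "uniform_on Q M K (cells M) (Us 0) u0 p0"
  shows "r \<le> stages S \<Longrightarrow> uniform_on Q M K (cells M) (Us r) u0 p0"
proof (induction r rule: less_induct)
  case (less r)
  show ?case
  proof (cases "r = 0")
    case False
    then have r: "r \<in> {1..stages S}" using less.prems by auto
    obtain V where V: "\<And>l. l < stages S \<Longrightarrow> dg_operator Q M K bc (Us l) (V l)"
      and Uh: "Uh r = (\<lambda>i j \<alpha>. \<Sum>l<r. (rk_c S r l *\<^sub>R Us l i j \<alpha> + (\<Delta>t * rk_d S r l) *\<^sub>R V l i j \<alpha>))"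
      and Us: "Us r = oe_operator M K bc \<beta>x \<beta>y \<Delta>t (Uh r)"
      using step r unfolding oedg_step_def by blast
    have "modal M K (\<lambda>U. m (conserved U) - \<kappa> * U $ 6) c (Us r)" if trans: "transported Q u0 p0 m \<kappa> c" for m \<kappa> c
    proof -
      let ?l = "\<lambda>U. m (conserved U) - \<kappa> * U $ 6"
      note lin = linear_residual[OF trans]
      have "?l (Uh r i j \<alpha>) = (if \<alpha> = (0, 0) then c else 0)" if ij: "(i, j) \<in> cells M" and \<alpha>: "\<alpha> \<in> modes K" for i j \<alpha>
      proof -
        have "?l (Us l i j \<alpha>) = (if \<alpha> = (0, 0) then c else 0)" "?l (V l i j \<alpha>) = 0" if "l < r" for l
        proof -
          have uni: "uniform_on Q M K (cells M) (Us l) u0 p0" and "l < stages S"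
            using less that by auto
          show "?l (Us l i j \<alpha>) = (if \<alpha> = (0, 0) then c else 0)"
          proof -
            have "modal M K ?l c (Us l)"
              using uni trans by (simp add: uniform_on_modal_iff[OF M])
            then show ?thesis
              using ij \<alpha> unfolding modal_def by blast
          qed
          show "?l (V l i j \<alpha>) = 0"
            by (rule dg_operator_residual_zero[OF M bc uni V[OF \<open>l < stages S\<close>] trans ij \<alpha>])
        qed
        then have "?l (Uh r i j \<alpha>) = (\<Sum>l<r. rk_c S r l * (if \<alpha> = (0, 0) then c else 0))"
          unfolding Uh linear_sum[OF lin] linear_add[OF lin] linear_cmul[OF lin]
          by (intro sum.cong) simp_all
        \<comment> \<open>The increments \<open>V l\<close> have dropped out, and the weights
          \<open>rk_c\<close> sum to 1, so the constant term is reproduced exactly.\<close>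
        also have "\<dots> = (if \<alpha> = (0, 0) then c else 0)"
          using ssp r by (simp add: ssp_def sum_distrib_right[symmetric])
        finally show ?thesis .
      qed
      then have "modal M K ?l c (Uh r)"
        unfolding modal_def by blast
      then show ?thesis
        unfolding Us by (rule modal_oe_operator[OF lin])
    qed
    then show ?thesis
      using defined less.prems by (simp add: uniform_on_modal_iff[OF M])
  qed (use init in simp)
qed

theorem theorem4p1:
  fixes Q :: eos and M :: mesh and K :: nat and S :: rk_scheme
    and bc :: "dof \<Rightarrow> dof" and \<beta>x \<beta>y :: speed_estimate
    and \<Delta>t :: real and U :: "nat \<Rightarrow> dof" and Uh Us :: "nat \<Rightarrow> dof" and n :: nat
    and u0 :: "real \<times> real" and p0 :: real
  assumes mesh: "valid_mesh M"
    and bc: "extends_mesh_data M bc" "bc_compatible Q M K bc u0 p0"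
    and dt: "\<Delta>t > 0"
    and ssp: "ssp S"
    and step: "oedg_step Q M K bc \<beta>x \<beta>y S \<Delta>t (U n) Uh Us (U (Suc n))"
    and defined: "\<forall>r\<le>stages S. well_defined_on Q M K (cells M) (Us r)"
    and u_n: "velocity_is M K (cells M) (oe_operator M K bc \<beta>x \<beta>y \<Delta>t (U n)) u0"
    and p_n: "pressure_is Q M K (cells M) (oe_operator M K bc \<beta>x \<beta>y \<Delta>t (U n)) p0"
  shows "velocity_is M K (cells M) (oe_operator M K bc \<beta>x \<beta>y \<Delta>t (U (Suc n))) u0 \<and>
         pressure_is Q M K (cells M) (oe_operator M K bc \<beta>x \<beta>y \<Delta>t (U (Suc n))) p0"
proof -
  have "Us 0 = oe_operator M K bc \<beta>x \<beta>y \<Delta>t (U n)"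
    using step by (simp add: oedg_step_def)
  then have "uniform_on Q M K (cells M) (Us 0) u0 p0"
    using defined u_n p_n by (metis uniform_on_iff le0)
  then have "uniform_on Q M K (cells M) (Us (stages S)) u0 p0"
    by (rule uniform_on_rk_stages[OF mesh bc ssp step defined]) simp
  \<comment> \<open>\<open>ssp\<close> provides at least one stage, so the last stage satisfies the
    recursion and its damped value is the damped solution at the new time level.\<close>
  moreover have "Us (stages S) = oe_operator M K bc \<beta>x \<beta>y \<Delta>t (U (Suc n))"
    using step ssp unfolding oedg_step_def ssp_def by (metis atLeastAtMost_iff order_refl)
  ultimately show ?thesis
    by (simp add: uniform_on_iff)
qed

end
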